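(* Let $n\ge 1$ be an integer, $\Omega=\{x\in\mathbb{R}^n : x_n\ge 0\}$, $\partial\Omega=\{x\in\mathbb{R}^n: x_n=0\}$, $T_{\max}>0$, and let $u:[0,T_{\max}]\times\Omega\to\mathbb{R}$ be a smooth function (up to the boundary) satisfying $\frac{\partial u}{\partial t}=\Delta u$ in $\Omega$ and $u(0,x)=0$ for all $x\in\Omega$. Assume that for each multi-index $\gamma\in\mathbb{N}^n$ there exists $C>0$ such that $|D^\gamma u(t,x)|\le Ce^{C|x|}$ for all $t\in[0,T_{\max}]$ and $x\in\Omega$. Define, for $t\in[0,T_{\max}]$ and $x\in\partial\Omega$, the boundary temperature $g(t,x)=u(t,x)$ and the boundary flux $q(t,x)=-\frac{\partial u}{\partial x_n}(t,x)$. Then for all $t\in(0,T_{\max}]$ and $x\in\partial\Omega$, $$g(t,x)=\int_0^t\frac{q(s,x)}{(\pi(t-s))^{1/2}}\,ds+\int_0^t\int_{\partial\Omega}(q(s,y)-q(s,x))\,\frac{2\exp\left(-\frac{|x-y|^2}{4(t-s)}\right)}{(4\pi(t-s))^{n/2}}\,dy\,ds.$$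
   Context: $D^\gamma$ denotes the spatial partial derivative with respect to the multi-index $\gamma=(\gamma_1,\dots,\gamma_n)$. The measure $dy$ on $\partial\Omega\cong\mathbb{R}^{n-1}$ is $(n-1)$-dimensional Lebesgue measure (for $n=1$, $\partial\Omega$ is a single point with unit mass). The double integral is an iterated integral, with the spatial integration performed first. *)

theory Defs
  imports "HOL-Analysis.Analysis"
begin

text \<open>
  Vectors in R^n are elements of \<open>real ^ 'n\<close>, where the finite linear order on the index type
  provides the notion of last coordinate. Functions on a set \<open>S\<close> are total functions of which only
  the values on \<open>S\<close> are used; at boundary points of \<open>S\<close>, derivatives are one-sided.
\<close>

definition partial_within ::
    "'a::euclidean_space set \<Rightarrow> 'a \<Rightarrow> ('a \<Rightarrow> real) \<Rightarrow> 'a \<Rightarrow> real" where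
  "partial_within S v f x =
     vector_derivative (\<lambda>h. f (x + h *\<^sub>R v)) (at 0 within {h. x + h *\<^sub>R v \<in> S})"

definition has_partial_within ::
    "'a::euclidean_space set \<Rightarrow> 'a \<Rightarrow> ('a \<Rightarrow> real) \<Rightarrow> 'a \<Rightarrow> bool" where
  "has_partial_within S v f x \<longleftrightarrow>
     (\<lambda>h. f (x + h *\<^sub>R v)) differentiable (at 0 within {h. x + h *\<^sub>R v \<in> S})"

primrec Ck_on :: "nat \<Rightarrow> 'a::euclidean_space set \<Rightarrow> ('a \<Rightarrow> real) \<Rightarrow> bool" where
  "Ck_on 0 S f \<longleftrightarrow> continuous_on S f"
| "Ck_on (Suc k) S f \<longleftrightarrow> continuous_on S f \<and>
     (\<forall>v\<in>Basis. (\<forall>x\<in>S. has_partial_within S v f x) \<and> Ck_on k S (partial_within S v f))"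

definition smooth_on :: "'a::euclidean_space set \<Rightarrow> ('a \<Rightarrow> real) \<Rightarrow> bool" where
  "smooth_on S f \<longleftrightarrow> (\<forall>k. Ck_on k S f)"

abbreviation last_index :: "'n::{finite,linorder}" where
  "last_index \<equiv> Max UNIV"

definition half_space :: "(real ^ 'n::{finite,linorder}) set" where
  "half_space = {x. x $ last_index \<ge> 0}"

definition half_space_boundary :: "(real ^ 'n::{finite,linorder}) set" where
  "half_space_boundary = {x. x $ last_index = 0}"

definition space_partial ::
    "'n::{finite,linorder} \<Rightarrow> (real ^ 'n::{finite,linorder} \<Rightarrow> real) \<Rightarrow> real ^ 'n::{finite,linorder} \<Rightarrow> real" where
  "space_partial i = partial_within half_space (axis i 1)"

text \<open>The factors are applied in the order \<open>\<partial>\<^sub>1^(\<gamma> 1) (\<partial>\<^sub>2^(\<gamma> 2) (\<dots> (\<partial>\<^sub>n^(\<gamma> n) f)))\<close>.\<close>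

definition multi_partial ::
    "('n::{finite,linorder} \<Rightarrow> nat) \<Rightarrow> (real ^ 'n::{finite,linorder} \<Rightarrow> real) \<Rightarrow> real ^ 'n::{finite,linorder} \<Rightarrow> real" where
  "multi_partial \<gamma> f = foldr (\<lambda>i. space_partial i ^^ \<gamma> i) (sorted_list_of_set UNIV) f"

definition laplacian ::
    "(real ^ 'n::{finite,linorder} \<Rightarrow> real) \<Rightarrow> real ^ 'n::{finite,linorder} \<Rightarrow> real" where
  "laplacian f x = (\<Sum>i\<in>UNIV. space_partial i (space_partial i f) x)"

definition boundary_embed ::
    "('n::{finite,linorder} \<Rightarrow> real) \<Rightarrow> real ^ 'n::{finite,linorder}" where
  "boundary_embed z = (\<chi> i. if i = last_index then 0 else z i)"

text \<open>
  Lebesgue measure of dimension \<open>n - 1\<close>, carried by the boundary itself. For \<open>n = 1\<close> the product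
  is over the empty index set, so this is the unit mass at the single boundary point.
\<close>

definition boundary_measure :: "(real ^ 'n::{finite,linorder}) measure" where
  "boundary_measure =
     distr (Pi\<^sub>M (UNIV - {last_index}) (\<lambda>_. lborel)) (restrict_space borel half_space_boundary)
       boundary_embed"

lemma measurable_boundary_embed [measurable]:
  "(boundary_embed :: _ \<Rightarrow> real ^ 'n::{finite,linorder}) \<in>
     measurable (Pi\<^sub>M (UNIV - {last_index}) (\<lambda>_. lborel)) (restrict_space borel half_space_boundary)"
proof (rule measurable_restrict_space2)
  show "(boundary_embed :: _ \<Rightarrow> real ^ 'n::{finite,linorder}) \<in>
      space (Pi\<^sub>M (UNIV - {last_index}) (\<lambda>_. lborel)) \<rightarrow> half_space_boundary"
    by (auto simp: boundary_embed_def half_space_boundary_def)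
  have "(\<lambda>z. if i = last_index then 0 else z i) \<in>
      borel_measurable (Pi\<^sub>M (UNIV - {last_index}) (\<lambda>_. lborel :: real measure))" for i :: "'n::{finite,linorder}"
  proof (cases "i = last_index")
    case False
    then have "(\<lambda>z. z i) \<in> measurable (Pi\<^sub>M (UNIV - {last_index}) (\<lambda>_. lborel :: real measure)) lborel"
      by (intro measurable_component_singleton) auto
    with False show ?thesis by simp
  qed simp
  then show "(boundary_embed :: _ \<Rightarrow> real ^ 'n::{finite,linorder}) \<in>
      borel_measurable (Pi\<^sub>M (UNIV - {last_index}) (\<lambda>_. lborel))"
    unfolding boundary_embed_def
    by (subst borel_measurable_euclidean_space) (auto simp: Basis_vec_def inner_axis)
qed

text \<open>The Neumann heat kernel of the half-space at boundary points: twice the Gaussian, by reflection.\<close>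

definition boundary_kernel ::
    "real \<Rightarrow> real ^ 'n::{finite,linorder} \<Rightarrow> real ^ 'n::{finite,linorder} \<Rightarrow> real" where
  "boundary_kernel \<tau> x y =
     2 * exp (- (norm (x - y))\<^sup>2 / (4 * \<tau>)) / (4 * pi * \<tau>) powr (real CARD('n) / 2)"

end

theory Submission
  imports Defs "HOL-Probability.Distributions" "HOL-Real_Asymp.Real_Asymp"
begin

text \<open>
  Fix \<open>t\<close> and a boundary point \<open>x\<close>, and follow \<open>u\<close> along the parabolic curves
  \<open>r \<mapsto> (t - r\<^sup>2, x + r z)\<close>, weighted by \<open>\<Phi> z = exp (- |z|\<^sup>2 / 4)\<close>. The heat equation and
  \<open>\<partial>\<^sub>i \<Phi> = - z\<^sub>i / 2 * \<Phi>\<close> turn the \<open>r\<close>-derivative of \<open>u (t - r\<^sup>2, x + r z) \<Phi> z\<close> into the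
  divergence \<open>- 2 * (\<Sum>i. \<partial>\<^sub>z\<^sub>i ((\<partial>\<^sub>i u) (t - r\<^sup>2, x + r z) \<Phi> z))\<close>, with no singularity at \<open>r = 0\<close>.
  Integrating over \<open>0 \<le> r \<le> \<surd>t\<close> leaves only \<open>- u (t, x) \<Phi> z\<close>, since \<open>u\<close> vanishes initially;
  integrating over \<open>z\<close> in the half space leaves only the normal flux on the boundary. The substitutions
  \<open>s = t - r\<^sup>2\<close> and \<open>y = x + r z\<close> give \<open>u (t, x) = \<integral>\<integral> q (s, y) K (t - s, x, y) dy ds\<close>,
  and subtracting \<open>q (s, x)\<close> under the integral gives the claim because the
  kernel \<open>K \<tau> x\<close> has mass \<open>1 / \<surd>(\<pi> \<tau>)\<close>.
\<close>

subsection \<open>Preliminaries\<close>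

text \<open>Exchange the coordinates of \<open>x\<close> for those of \<open>y\<close> one at a time
  and use the mean value inequality on each coordinate segment. By \<open>mix\<close> the corners of
  this path lie in \<open>S\<close>, and by convexity so do its segments; this makes the argument
  work at boundary points, where the partials are one-sided.\<close>

lemma has_derivative_of_continuous_partials:
  fixes f :: "'a::euclidean_space \<Rightarrow> real"
  assumes mix: "\<And>x y A. x \<in> S \<Longrightarrow> y \<in> S \<Longrightarrow> A \<subseteq> Basis \<Longrightarrow> x + (\<Sum>b\<in>A. ((y - x) \<bullet> b) *\<^sub>R b) \<in> S"
    and "convex S"
    and partial: "\<And>x b. x \<in> S \<Longrightarrow> b \<in> Basis \<Longrightarrow>
      ((\<lambda>h. f (x + h *\<^sub>R b)) has_real_derivative D b x) (at 0 within {h. x + h *\<^sub>R b \<in> S})"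
    and cont: "\<And>b. b \<in> Basis \<Longrightarrow> continuous_on S (D b)"
    and x: "x \<in> S"
  shows "(f has_derivative (\<lambda>h. \<Sum>b\<in>Basis. (h \<bullet> b) * D b x)) (at x within S)"
proof -
  \<comment> \<open>\<open>m A y\<close> takes the coordinates in \<open>A\<close> from
    \<open>y\<close> and the others from \<open>x\<close>. The estimate is proved by induction on
    \<open>A\<close>; at \<open>A = Basis\<close> the point is \<open>y\<close> itself.\<close>
  define m where "m A y = x + (\<Sum>b\<in>A. ((y - x) \<bullet> b) *\<^sub>R b)" for A y
  define N where "N = real DIM('a)"
  have N: "N \<ge> 1" by (simp add: N_def Suc_le_eq)
  have claim: "\<forall>e>0. \<exists>\<delta>>0. \<forall>y\<in>S. dist y x < \<delta> \<longrightarrow>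
      \<bar>f (m A y) - f x - (\<Sum>b\<in>A. ((y - x) \<bullet> b) * D b x)\<bar> \<le> e * norm (y - x)"
    if "finite A" "A \<subseteq> Basis" for A
    using that
  proof (induction A rule: finite_induct)
    case empty
    then show ?case by (auto simp: m_def intro: exI[of _ 1])
  next
    case (insert b A)
    show ?case
    proof (intro allI impI)
      fix e :: real assume e: "e > 0"
      then obtain \<delta>1 where \<delta>1: "\<delta>1 > 0" and A: "\<And>y. y \<in> S \<Longrightarrow> dist y x < \<delta>1 \<Longrightarrow>
          \<bar>f (m A y) - f x - (\<Sum>b\<in>A. ((y - x) \<bullet> b) * D b x)\<bar> \<le> e / 2 * norm (y - x)"
        using insert.IH insert.prems by (metis half_gt_zero insert_subset)
      from cont[of b] x e insert.prems obtain \<delta>2 where \<delta>2: "\<delta>2 > 0"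
        and c: "\<And>p. p \<in> S \<Longrightarrow> dist p x < \<delta>2 \<Longrightarrow> dist (D b p) (D b x) < e / 2"
        unfolding continuous_on_iff by (metis half_gt_zero insert_subset)
      show "\<exists>\<delta>>0. \<forall>y\<in>S. dist y x < \<delta> \<longrightarrow>
          \<bar>f (m (insert b A) y) - f x - (\<Sum>b\<in>insert b A. ((y - x) \<bullet> b) * D b x)\<bar> \<le> e * norm (y - x)"
      \<comment> \<open>A point of the new segment differs from \<open>x\<close> by at most
        \<open>N\<close> coordinate increments of size at most \<open>norm (y - x)\<close>. Hence
        the radius \<delta>2 / \<open>N\<close> keeps the segment where \<open>D b\<close> is within
        e / 2 of \<open>D b x\<close>.\<close>
      proof (intro exI[of _ "min \<delta>1 (\<delta>2 / N)"] conjI ballI impI)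
        show "min \<delta>1 (\<delta>2 / N) > 0" using \<delta>1 \<delta>2 N by simp
        fix y assume y: "y \<in> S" "dist y x < min \<delta>1 (\<delta>2 / N)"
        define k where "k = (y - x) \<bullet> b"
        have seg: "m A y + h *\<^sub>R b \<in> S \<and> dist (m A y + h *\<^sub>R b) x < \<delta>2"
          if h: "h \<in> closed_segment 0 k" for h
        proof
          from h obtain \<theta> where \<theta>: "0 \<le> \<theta>" "\<theta> \<le> 1" "h = \<theta> * k"
            by (auto simp: closed_segment_def)
          have "m A y \<in> S" "m (insert b A) y \<in> S"
            using mix[OF x y(1)] insert.prems by (auto simp: m_def)
          then have "(1 - \<theta>) *\<^sub>R m A y + \<theta> *\<^sub>R m (insert b A) y \<in> S"
            using \<open>convex S\<close> \<theta> by (simp add: convex_alt)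
          also have "(1 - \<theta>) *\<^sub>R m A y + \<theta> *\<^sub>R m (insert b A) y = m A y + h *\<^sub>R b"
            using insert.hyps by (simp add: m_def \<theta> k_def algebra_simps)
          finally show "m A y + h *\<^sub>R b \<in> S" .
          have bd: "\<bar>(y - x) \<bullet> b'\<bar> \<le> norm (y - x)" if "b' \<in> Basis" for b'
            using Basis_le_norm[OF that] by simp
          have "dist (m A y + h *\<^sub>R b) x = norm ((\<Sum>b\<in>A. ((y - x) \<bullet> b) *\<^sub>R b) + h *\<^sub>R b)"
            by (simp add: m_def dist_norm algebra_simps)
          also have "\<dots> \<le> (\<Sum>b\<in>A. norm (y - x)) + norm (y - x)"
          proof (intro norm_triangle_le add_mono order_trans[OF norm_sum] sum_mono)
            fix b' assume "b' \<in> A"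
            then show "norm (((y - x) \<bullet> b') *\<^sub>R b') \<le> norm (y - x)"
              using bd insert.prems by (auto simp: subset_iff)
          next
            have "\<bar>h\<bar> \<le> \<bar>k\<bar>" using \<theta> by (simp add: abs_mult mult_left_le_one_le)
            then show "norm (h *\<^sub>R b) \<le> norm (y - x)"
              using bd[of b] insert.prems by (auto simp: k_def)
          qed
          also have "\<dots> = real (card (insert b A)) * norm (y - x)"
            using insert.hyps by (simp add: algebra_simps)
          also have "\<dots> \<le> N * norm (y - x)"
            unfolding N_def using insert.prems
            by (intro mult_right_mono) (auto simp del: card_insert_disjoint intro!: card_mono)
          also have "\<dots> < \<delta>2"
            using y(2) N by (simp add: dist_norm field_simps)
          finally show "dist (m A y + h *\<^sub>R b) x < \<delta>2" .
        qed
        \<comment> \<open>Subtracting the linear term leaves a function whose derivative along the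
          segment is below e / 2 in absolute value. The translation by \<open>h\<close> carries the
          one-sided derivative from increment 0 to the parameter \<open>h\<close>.\<close>
        have der: "((\<lambda>h. f (m A y + h *\<^sub>R b) - h * D b x) has_field_derivative
            (D b (m A y + h *\<^sub>R b) - D b x)) (at h within closed_segment 0 k)"
          if h: "h \<in> closed_segment 0 k" for h
        proof -
          have "((\<lambda>h'. f (m A y + (h + h') *\<^sub>R b)) has_real_derivative D b (m A y + h *\<^sub>R b))
              (at 0 within {h'. m A y + (h + h') *\<^sub>R b \<in> S})"
            using partial[of "m A y + h *\<^sub>R b" b] seg[OF h] insert.prems by (simp add: algebra_simps)
          then have "((\<lambda>h'. f (m A y + (h + h') *\<^sub>R b)) has_real_derivative D b (m A y + h *\<^sub>R b))
              (at 0 within (\<lambda>z. z - h) ` closed_segment 0 k)"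
            by (rule DERIV_subset) (use seg in auto)
          then have "((\<lambda>h. f (m A y + h *\<^sub>R b)) has_real_derivative D b (m A y + h *\<^sub>R b))
              (at (0 + h) within (+) h ` ((\<lambda>z. z - h) ` closed_segment 0 k))"
            by (subst DERIV_at_within_shift[where z = h and x = 0, simplified add.commute]) (simp add: add.commute)
          also have "(+) h ` ((\<lambda>z. z - h) ` closed_segment 0 k) = closed_segment 0 k"
            by (simp add: image_image)
          finally show ?thesis by (auto intro!: derivative_eq_intros)
        qed
        have "norm ((f (m A y + k *\<^sub>R b) - k * D b x) - (f (m A y + 0 *\<^sub>R b) - 0 * D b x)) \<le> e / 2 * norm (k - 0)"
          by (rule field_differentiable_bound[OF _ der])
            (use c seg in \<open>auto simp: dist_real_def less_imp_le\<close>)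
        moreover have "m A y + k *\<^sub>R b = m (insert b A) y"
          using insert.hyps by (simp add: m_def k_def algebra_simps)
        moreover have "e / 2 * \<bar>k\<bar> \<le> e / 2 * norm (y - x)"
          using Basis_le_norm[of b "y - x"] insert.prems e by (simp add: k_def)
        ultimately have "\<bar>f (m (insert b A) y) - f (m A y) - k * D b x\<bar> \<le> e / 2 * norm (y - x)"
          by (simp add: algebra_simps)
        moreover have "\<bar>f (m A y) - f x - (\<Sum>b\<in>A. ((y - x) \<bullet> b) * D b x)\<bar> \<le> e / 2 * norm (y - x)"
          using A y by simp
        moreover have "(\<Sum>b\<in>insert b A. ((y - x) \<bullet> b) * D b x) = k * D b x + (\<Sum>b\<in>A. ((y - x) \<bullet> b) * D b x)"
          using insert.hyps by (simp add: k_def)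
        ultimately
        show "\<bar>f (m (insert b A) y) - f x - (\<Sum>b\<in>insert b A. ((y - x) \<bullet> b) * D b x)\<bar> \<le> e * norm (y - x)"
          by linarith
      qed
    qed
  qed
  show ?thesis
    unfolding has_derivative_within_alt2
  proof (intro conjI allI impI)
    show "bounded_linear (\<lambda>h. \<Sum>b\<in>Basis. (h \<bullet> b) * D b x)"
      by (intro bounded_linear_sum bounded_linear_mult_const bounded_linear_inner_left)
    fix e :: real assume "e > 0"
    with claim[of Basis] obtain \<delta> where "\<delta> > 0" and \<delta>: "\<And>y. y \<in> S \<Longrightarrow> dist y x < \<delta> \<Longrightarrow>
        \<bar>f (m Basis y) - f x - (\<Sum>b\<in>Basis. ((y - x) \<bullet> b) * D b x)\<bar> \<le> e * norm (y - x)"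
      by auto
    have "m Basis y = y" for y by (simp add: m_def euclidean_representation)
    with \<delta> \<open>\<delta> > 0\<close>
    show "\<forall>\<^sub>F y in at x within S. norm (f y - f x - (\<Sum>b\<in>Basis. ((y - x) \<bullet> b) * D b x)) \<le> e * norm (y - x)"
      by (auto simp: eventually_at)
  qed
qed

section \<open>Gaussian integrals on the line\<close>

lemma has_bochner_integral_gaussian:
  "has_bochner_integral lborel (\<lambda>y::real. exp (- y\<^sup>2)) (sqrt pi)"
  using has_bochner_integral_even_function[OF gaussian_moment_0] by simp

text \<open>A dilation by 1 / 2 reduces both to the standard Gaussian. The full line serves the
  tangential coordinates, the half line the normal one.\<close>

lemma gaussian_integral_quarter:
  "(LINT y|lborel. exp (- y\<^sup>2 / 4)) = sqrt (4 * pi)"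
  "(LINT y|lborel. indicator {0..} y * exp (- y\<^sup>2 / 4)) = sqrt pi"
proof -
  have "sqrt pi = (LINT y|lborel. exp (- (0 + 1 / 2 * y)\<^sup>2)) / 2"
    using has_bochner_integral_integral_eq[OF has_bochner_integral_gaussian]
    by (subst (asm) lborel_integral_real_affine[of "1 / 2" _ 0]) auto
  then show "(LINT y|lborel. exp (- y\<^sup>2 / 4)) = sqrt (4 * pi)"
    by (simp add: power_divide real_sqrt_mult)
  have "sqrt pi / 2 = (LINT y|lborel. indicator {0..} (0 + 1 / 2 * y) * exp (- (0 + 1 / 2 * y)\<^sup>2)) / 2"
    using has_bochner_integral_integral_eq[OF gaussian_moment_0]
    by (subst (asm) lborel_integral_real_affine[of "1 / 2" _ 0]) auto
  moreover have "indicator {0..} (0 + 1 / 2 * y) = (indicator {0..} y :: real)" for y :: real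
    by (simp add: indicator_def)
  ultimately show "(LINT y|lborel. indicator {0..} y * exp (- y\<^sup>2 / 4)) = sqrt pi"
    by (simp add: power_divide)
qed

lemma integrable_exp_abs_gaussian:
  fixes B :: real
  shows "integrable lborel (\<lambda>y. exp (B * \<bar>y\<bar> - y\<^sup>2 / 4))"
proof -
  have g: "integrable lborel (\<lambda>y::real. exp (- y\<^sup>2))"
    using has_bochner_integral_gaussian by (simp add: has_bochner_integral_iff)
  then have "integrable lborel (\<lambda>y::real. exp (- (0 + 1 / sqrt 8 * y)\<^sup>2))"
    by (rule lborel_integrable_real_affine) simp
  then have "integrable lborel (\<lambda>y::real. exp (2 * B\<^sup>2) * exp (- (0 + 1 / sqrt 8 * y)\<^sup>2))"
    by (rule integrable_mult_right)
  then show ?thesis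
  proof (rule Bochner_Integration.integrable_bound)
    show "AE y in lborel. norm (exp (B * \<bar>y\<bar> - y\<^sup>2 / 4)) \<le> norm (exp (2 * B\<^sup>2) * exp (- (0 + 1 / sqrt 8 * y)\<^sup>2))"
    proof (rule AE_I2)
      fix y :: real
      \<comment> \<open>Completing the square: the difference of the two exponents compared below is
        (4 B - |y|)^2 / 8.\<close>
      have "0 \<le> (4 * B - \<bar>y\<bar>)\<^sup>2" by simp
      then have "B * \<bar>y\<bar> - y\<^sup>2 / 4 \<le> 2 * B\<^sup>2 - y\<^sup>2 / 8"
        by (simp add: power2_diff algebra_simps power_mult_distrib)
      then show "norm (exp (B * \<bar>y\<bar> - y\<^sup>2 / 4)) \<le> norm (exp (2 * B\<^sup>2) * exp (- (0 + 1 / sqrt 8 * y)\<^sup>2))"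
        by (simp add: exp_add[symmetric] power_mult_distrib power_divide)
    qed
  qed simp
qed

lemma tendsto_exp_abs_gaussian:
  fixes B :: real
  shows "((\<lambda>y. exp (B * \<bar>y\<bar> - y\<^sup>2 / 4)) \<longlongrightarrow> 0) at_top" "((\<lambda>y. exp (B * \<bar>y\<bar> - y\<^sup>2 / 4)) \<longlongrightarrow> 0) at_bot"
  by real_asymp+

section \<open>Product Lebesgue measure\<close>

lemma product_sigma_finite_lborel: "product_sigma_finite (\<lambda>_. lborel :: real measure)"
  by standard

text \<open>A product measure is determined by its values on boxes, where each coordinate
  contributes one factor \<open>c\<close>. The index set may be empty, as it is for the boundary
  when n = 1.\<close>

lemma PiM_lborel_affine:
  fixes a :: "'i \<Rightarrow> real" and c :: real
  assumes "finite I" "c > 0"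
  shows "(\<Pi>\<^sub>M i\<in>I. lborel) =
    density (distr (\<Pi>\<^sub>M i\<in>I. lborel) (\<Pi>\<^sub>M i\<in>I. lborel) (\<lambda>z. \<lambda>i\<in>I. a i + c * z i)) (\<lambda>_. ennreal (c ^ card I))"
proof -
  interpret product_sigma_finite "\<lambda>_. lborel :: real measure" by (rule product_sigma_finite_lborel)
  interpret finite_product_sigma_finite "\<lambda>_. lborel :: real measure" I by standard fact
  have [measurable]: "(\<lambda>z. \<lambda>i\<in>I. a i + c * z i) \<in> (\<Pi>\<^sub>M i\<in>I. lborel) \<rightarrow>\<^sub>M (\<Pi>\<^sub>M i\<in>I. lborel)"
    by measurable
  show ?thesis
  proof (rule PiM_eqI[symmetric])
    fix A :: "'i \<Rightarrow> real set" assume A: "\<And>i. i \<in> I \<Longrightarrow> A i \<in> sets lborel"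
    have pre: "(\<lambda>z. a i + c * z) -` A i \<in> sets lborel" if "i \<in> I" for i
      using A[OF that] by (auto intro!: measurable_sets_borel[where M=borel])
    have "(\<lambda>z. \<lambda>i\<in>I. a i + c * z i) -` (Pi\<^sub>E I A) \<inter> space (\<Pi>\<^sub>M i\<in>I. lborel) = (\<Pi>\<^sub>E i\<in>I. (\<lambda>z. a i + c * z) -` A i)"
      by (auto simp: space_PiM PiE_iff)
    then have "emeasure (density (distr (\<Pi>\<^sub>M i\<in>I. lborel) (\<Pi>\<^sub>M i\<in>I. lborel) (\<lambda>z. \<lambda>i\<in>I. a i + c * z i)) (\<lambda>_. ennreal (c ^ card I))) (Pi\<^sub>E I A)
        = ennreal (c ^ card I) * (\<Prod>i\<in>I. emeasure lborel ((\<lambda>z. a i + c * z) -` A i))"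
      using A pre by (simp add: emeasure_density_const emeasure_distr emeasure_PiM sets_PiM_I_finite assms)
    also have "\<dots> = (\<Prod>i\<in>I. ennreal c * emeasure lborel ((\<lambda>z. a i + c * z) -` A i))"
      using assms by (simp add: prod.distrib ennreal_power)
    also have "\<dots> = (\<Prod>i\<in>I. emeasure lborel (A i))"
    proof (rule prod.cong[OF refl])
      fix i assume i: "i \<in> I"
      show "ennreal c * emeasure lborel ((\<lambda>z. a i + c * z) -` A i) = emeasure lborel (A i)"
        using A[OF i] assms
        by (subst (2) lborel_real_affine[of c "a i"]) (auto simp: emeasure_density_const emeasure_distr)
    qed
    finally show "emeasure (density (distr (\<Pi>\<^sub>M i\<in>I. lborel) (\<Pi>\<^sub>M i\<in>I. lborel) (\<lambda>z. \<lambda>i\<in>I. a i + c * z i)) (\<lambda>_. ennreal (c ^ card I))) (Pi\<^sub>E I A) = (\<Prod>i\<in>I. emeasure lborel (A i))" .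
  qed (use assms in auto)
qed

lemma (in pair_sigma_finite) integrable_pair_bound:
  fixes f :: "_ \<Rightarrow> real"
  assumes f: "f \<in> borel_measurable (M1 \<Otimes>\<^sub>M M2)"
    and a: "integrable M1 a" and b: "integrable M2 b"
    and bound: "\<And>x y. \<bar>f (x, y)\<bar> \<le> a x * b y"
  shows "integrable (M1 \<Otimes>\<^sub>M M2) f"
proof (rule Bochner_Integration.integrable_bound[OF _ f])
  have [measurable]: "a \<in> borel_measurable M1" "b \<in> borel_measurable M2"
    using a b by auto
  show "integrable (M1 \<Otimes>\<^sub>M M2) (\<lambda>(x, y). a x * b y)"
  proof (rule Fubini_integrable)
    show "integrable M1 (\<lambda>x. LINT y|M2. norm (case (x, y) of (x, y) \<Rightarrow> a x * b y))"
      using a b by (simp add: abs_mult)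
    show "AE x in M1. integrable M2 (\<lambda>y. case (x, y) of (x, y) \<Rightarrow> a x * b y)"
      using b by (intro AE_I2) simp
  qed measurable
  show "AE p in M1 \<Otimes>\<^sub>M M2. norm (f p) \<le> norm (case p of (x, y) \<Rightarrow> a x * b y)"
    using bound by (auto intro!: AE_I2 order_trans[OF _ abs_ge_self])
qed

section \<open>Integrals of derivatives over lines and half lines\<close>

lemma integral_derivative_whole_line:
  fixes F f :: "real \<Rightarrow> real"
  assumes F: "\<And>y. (F has_real_derivative f y) (at y)"
    and f: "continuous_on UNIV f" "integrable lborel f"
    and lim: "(F \<longlongrightarrow> 0) at_top" "(F \<longlongrightarrow> 0) at_bot"
  shows "(LINT y|lborel. f y) = 0"
proof -
  have "(LBINT y=-\<infinity>..\<infinity>. f y) = 0 - 0"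
  proof (rule interval_integral_FTC_integrable)
    show "(F has_vector_derivative f y) (at y)" for y
      using F by (simp add: has_real_derivative_iff_has_vector_derivative)
    show "isCont f y" for y using f(1) by (simp add: continuous_on_eq_continuous_at)
  qed (use f(2) lim in \<open>simp_all add: ereal_tendsto_simps set_integrable_def\<close>)
  then show ?thesis by (simp add: interval_lebesgue_integral_def set_lebesgue_integral_def)
qed

text \<open>At 0 the derivative is one-sided, so the fundamental theorem is applied on the open half
  line. Continuity of \<open>F\<close> at 0 supplies the boundary value, and the removed endpoint is
  a null set.\<close>

lemma integral_derivative_half_line:
  fixes F f :: "real \<Rightarrow> real"
  assumes F: "\<And>y. y \<ge> 0 \<Longrightarrow> (F has_real_derivative f y) (at y within {0..})"
    and f: "continuous_on {0..} f" "integrable lborel (\<lambda>y. indicator {0..} y * f y)"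
    and lim: "(F \<longlongrightarrow> 0) at_top"
  shows "(LINT y|lborel. indicator {0..} y * f y) = - F 0"
proof -
  have int: "integrable lborel (\<lambda>y. indicator {0<..} y * f y)"
  proof -
    have "(\<lambda>y. indicator {0<..} y *\<^sub>R (indicator {0..} y * f y)) = (\<lambda>y. indicator {0<..} y * f y)"
      by (auto simp: indicator_def fun_eq_iff)
    with integrable_mult_indicator[of "{0<..}", OF _ f(2)] show ?thesis by simp
  qed
  have ei: "einterval 0 \<infinity> = {0<..}" by (auto simp: einterval_def)
  have "(LBINT y=0..\<infinity>. f y) = 0 - F 0"
  proof (rule interval_integral_FTC_integrable)
    show "(F has_vector_derivative f y) (at y)" if "0 < ereal y" for y
    proof -
      from that have "y \<in> interior {0..}" by simp
      then have "at y within {0..} = at y" by (rule at_within_interior)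
      then show ?thesis
        using F[of y] that by (simp add: has_real_derivative_iff_has_vector_derivative)
    qed
    show "isCont f y" if "0 < ereal y" for y
      by (rule continuous_on_interior[OF f(1)]) (use that in simp)
    show "set_integrable lborel (einterval 0 \<infinity>) f"
      using int by (simp add: set_integrable_def ei)
    have "(F \<longlongrightarrow> F 0) (at 0 within {0..})"
      using DERIV_continuous[OF F[of 0]] by (simp add: continuous_within)
    then show "((F \<circ> real_of_ereal) \<longlongrightarrow> F 0) (at_right 0)"
      unfolding zero_ereal_def ereal_tendsto_simps by (rule tendsto_within_subset) auto
  qed (use lim in \<open>simp_all add: ereal_tendsto_simps\<close>)
  also have "(LBINT y=0..\<infinity>. f y) = (LINT y|lborel. indicator {0<..} y * f y)"
    by (simp add: interval_lebesgue_integral_def set_lebesgue_integral_def ei)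
  also have "\<dots> = (LINT y|lborel. indicator {0..} y * f y)"
    using int f(2)
  proof (intro integral_cong_AE)
    show "AE y in lborel. indicator {0<..} y * f y = indicator {0..} y * f y"
      using AE_lborel_singleton[of 0] by (rule eventually_mono) (auto simp: indicator_def)
  qed auto
  finally show ?thesis by simp
qed

lemma measurable_vec_lambda [measurable]:
  "(vec_lambda :: _ \<Rightarrow> real ^ 'n::finite) \<in> borel_measurable (Pi\<^sub>M UNIV (\<lambda>_. lborel))"
  by (subst borel_measurable_euclidean_space) (auto simp: Basis_vec_def inner_axis)

lemma vec_lambda_fun_upd:
  "vec_lambda (z(i := y)) = vec_lambda (z(i := 0)) + y *\<^sub>R (axis i 1 :: real ^ 'n::finite)"
  by (simp add: vec_eq_iff axis_def)

subsection \<open>The parabolic curves\<close>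

text \<open>
  \<open>v\<close> is the solution as a function on space-time; \<open>d i\<close> and \<open>dd i\<close> stand for \<open>\<partial>\<^sub>i v\<close> and
  \<open>\<partial>\<^sub>i \<partial>\<^sub>i v\<close>, and the heat equation is built into the time component of \<open>deriv_v\<close>.
\<close>

locale half_space_heat =
  fixes v :: "real \<times> (real ^ 'n::{finite,linorder}) \<Rightarrow> real"
    and d dd :: "'n::{finite,linorder} \<Rightarrow> real \<times> (real ^ 'n::{finite,linorder}) \<Rightarrow> real"
    and T C t :: real and x :: "real ^ 'n::{finite,linorder}"
  assumes cont: "continuous_on ({0..T} \<times> half_space) (d i)" "continuous_on ({0..T} \<times> half_space) (dd i)"
    and deriv_v: "p \<in> {0..T} \<times> half_space \<Longrightarrow>
      (v has_derivative (\<lambda>(h, k). h * (\<Sum>i\<in>UNIV. dd i p) + (\<Sum>i\<in>UNIV. k $ i * d i p))) (at p within {0..T} \<times> half_space)"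
    and deriv_d: "s \<in> {0..T} \<Longrightarrow> y \<in> half_space \<Longrightarrow>
      ((\<lambda>h. d i (s, y + h *\<^sub>R axis i 1)) has_real_derivative dd i (s, y)) (at 0 within {h. y + h *\<^sub>R axis i 1 \<in> half_space})"
    and initial: "y \<in> half_space \<Longrightarrow> v (0, y) = 0"
    and C: "C > 0"
    and growth_d: "s \<in> {0..T} \<Longrightarrow> y \<in> half_space \<Longrightarrow> \<bar>d i (s, y)\<bar> \<le> C * exp (C * norm y)"
    and growth_dd: "s \<in> {0..T} \<Longrightarrow> y \<in> half_space \<Longrightarrow> \<bar>dd i (s, y)\<bar> \<le> C * exp (C * norm y)"
    and t: "0 < t" "t \<le> T" and x: "x \<in> half_space_boundary"
begin

abbreviation "S \<equiv> {0..T} \<times> (half_space :: ((real, 'n) vec) set)"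
abbreviation "R \<equiv> sqrt t"
abbreviation "P \<equiv> Pi\<^sub>M (UNIV :: 'n set) (\<lambda>_. lborel :: real measure)"
abbreviation "Q \<equiv> Pi\<^sub>M (UNIV - {last_index :: 'n}) (\<lambda>_. lborel :: real measure)"

definition pt :: "real \<Rightarrow> ('n \<Rightarrow> real) \<Rightarrow> real \<times> ((real, 'n) vec)" where
  "pt r z = (t - r\<^sup>2, x + r *\<^sub>R vec_lambda z)"

text \<open>The weight exp (- |z|^2 / 4), written as a product so that Fubini can treat one
  coordinate at a time.\<close>

definition \<Phi> :: "('n \<Rightarrow> real) \<Rightarrow> real" where
  "\<Phi> z = (\<Prod>i\<in>UNIV. exp (- (z i)\<^sup>2 / 4))"

text \<open>One factor of an integrable majorant of \<open>G\<close> and \<open>G'\<close>. The term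
  \<open>C * R\<close> absorbs the growth exp (C |x + r z|) for r up to \<open>R\<close>; the
  summand 1 absorbs the linear factor \<open>z i\<close> in \<open>G'\<close>. What does not depend
  on \<open>z\<close> is collected in \<open>A\<close>.\<close>

definition w :: "real \<Rightarrow> real" where
  "w y = exp ((C * R + 1) * \<bar>y\<bar> - y\<^sup>2 / 4)"

definition A where "A = C * exp (C * norm x) * (R + 1)"

definition G :: "'n \<Rightarrow> real \<Rightarrow> ('n \<Rightarrow> real) \<Rightarrow> real" where
  "G i r z = d i (pt r z) * \<Phi> z"

text \<open>\<open>G' i\<close> is the derivative of \<open>G i\<close> in the coordinate \<open>z i\<close>.\<close>

definition G' :: "'n \<Rightarrow> real \<Rightarrow> ('n \<Rightarrow> real) \<Rightarrow> real" where
  "G' i r z = (r * dd i (pt r z) - z i / 2 * d i (pt r z)) * \<Phi> z"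

text \<open>Extension by zero to the whole product space, ready for Fubini. On the curves, the sum
  of the \<open>E i\<close> is - 1 / 2 times the r-derivative of
  \<open>v (pt r z) * \<Phi> z\<close>; each single \<open>E i\<close> is a derivative in
  \<open>z i\<close>.\<close>

definition E :: "'n \<Rightarrow> real \<times> ('n \<Rightarrow> real) \<Rightarrow> real" where
  "E i = (\<lambda>(r, z). indicator {0..R} r * indicator {0..} (z last_index) * G' i r z)"

section \<open>Growth bounds, measurability and integrability\<close>

lemma closed_S: "closed S"
proof -
  have "closed (half_space :: ((real, 'n) vec) set)"
    unfolding half_space_def by (intro closed_Collect_le continuous_intros)
  then show ?thesis by (intro closed_Times) auto
qed

lemma pt_in:
  assumes "r \<in> {0..R}" "z last_index \<ge> 0"
  shows "pt r z \<in> S"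
proof -
  have "r\<^sup>2 \<le> t" using assms(1) t power_mono[of r R 2] by simp
  moreover have "t - r\<^sup>2 \<le> T" using t zero_le_power2[of r] by linarith
  ultimately show ?thesis
    using assms t x by (auto simp: pt_def half_space_def half_space_boundary_def)
qed

lemma A_nonneg: "A \<ge> 0" using C t by (simp add: A_def)

lemma \<Phi>_nonneg: "\<Phi> z \<ge> 0" by (simp add: \<Phi>_def prod_nonneg)

lemma w_prod: "(\<Prod>i\<in>UNIV. w (z i)) = exp (C * R * (\<Sum>i\<in>UNIV. \<bar>z i\<bar>)) * exp (\<Sum>i\<in>UNIV. \<bar>z i\<bar>) * \<Phi> z"
  by (simp add: w_def \<Phi>_def exp_sum[symmetric] exp_add[symmetric] sum_negf sum_subtractf sum_distrib_left
      algebra_simps sum.distrib)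

text \<open>The Euclidean norm of \<open>z\<close> is replaced by the larger l1 norm, which makes
  the exponential factor over the coordinates.\<close>

lemma exp_pt_le:
  assumes "r \<in> {0..R}"
  shows "C * exp (C * norm (snd (pt r z))) \<le> C * exp (C * norm x) * exp (C * R * (\<Sum>i\<in>UNIV. \<bar>z i\<bar>))"
proof -
  have "norm (x + r *\<^sub>R vec_lambda z) \<le> norm x + r * norm (vec_lambda z)"
    using assms norm_triangle_ineq[of x "r *\<^sub>R vec_lambda z"] by simp
  also have "\<dots> \<le> norm x + R * (\<Sum>i\<in>UNIV. \<bar>z i\<bar>)"
    using assms norm_le_l1_cart[of "vec_lambda z"] t by (intro add_left_mono mult_mono) auto
  finally have "C * norm (x + r *\<^sub>R vec_lambda z) \<le> C * (norm x + R * (\<Sum>i\<in>UNIV. \<bar>z i\<bar>))"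
    using C by (intro mult_left_mono) auto
  then have "C * norm (x + r *\<^sub>R vec_lambda z) \<le> C * norm x + C * R * (\<Sum>i\<in>UNIV. \<bar>z i\<bar>)"
    by (simp only: distrib_left mult.assoc)
  then show ?thesis using C by (simp add: pt_def exp_add[symmetric])
qed

lemma G_bound:
  assumes "r \<in> {0..R}" "z last_index \<ge> 0"
  shows "\<bar>G i r z\<bar> \<le> A * (\<Prod>i\<in>UNIV. w (z i))"
proof -
  let ?L = "\<Sum>i\<in>UNIV. \<bar>z i\<bar>"
  have "fst (pt r z) \<in> {0..T}" "snd (pt r z) \<in> half_space"
    using pt_in[of r z] assms by (simp_all add: mem_Times_iff)
  from growth_d[OF this, of i] have "\<bar>d i (pt r z)\<bar> \<le> C * exp (C * norm (snd (pt r z)))" by simp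
  also note exp_pt_le[OF assms(1)]
  finally have "\<bar>G i r z\<bar> \<le> C * exp (C * norm x) * exp (C * R * ?L) * \<Phi> z"
    unfolding G_def abs_mult using \<Phi>_nonneg by (simp add: mult_right_mono)
  \<comment> \<open>The bound is weakened on purpose, so that \<open>G\<close> and \<open>G'\<close>
    share one majorant.\<close>
  also have "\<dots> * 1 \<le> \<dots> * ((R + 1) * exp ?L)"
    using t C \<Phi>_nonneg one_le_exp_iff[of ?L] mult_mono[of 1 "R + 1" 1 "exp ?L"]
    by (intro mult_left_mono) (auto simp: sum_nonneg)
  finally show ?thesis by (simp add: A_def w_prod mult_ac)
qed

lemma G'_bound:
  assumes "r \<in> {0..R}" "z last_index \<ge> 0"
  shows "\<bar>G' i r z\<bar> \<le> A * (\<Prod>i\<in>UNIV. w (z i))"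
proof -
  let ?L = "\<Sum>i\<in>UNIV. \<bar>z i\<bar>" and ?K = "C * exp (C * norm (snd (pt r z)))"
  have "fst (pt r z) \<in> {0..T}" "snd (pt r z) \<in> half_space"
    using pt_in[of r z] assms by (simp_all add: mem_Times_iff)
  from growth_d[OF this, of i] growth_dd[OF this, of i]
  have d: "\<bar>d i (pt r z)\<bar> \<le> ?K" "\<bar>dd i (pt r z)\<bar> \<le> ?K" by simp_all
  have "\<bar>r * dd i (pt r z) - z i / 2 * d i (pt r z)\<bar> \<le> \<bar>r\<bar> * ?K + \<bar>z i / 2\<bar> * ?K"
    by (rule order_trans[OF abs_triangle_ineq4]) (unfold abs_mult, intro add_mono mult_left_mono d, auto)
  also have "\<dots> = (r + \<bar>z i\<bar> / 2) * ?K" using assms by (simp add: algebra_simps)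
  also have "\<dots> \<le> ((R + 1) * exp ?L) * (C * exp (C * norm x) * exp (C * R * ?L))"
  proof (rule mult_mono[OF _ exp_pt_le[OF assms(1)]])
    \<comment> \<open>The linear factor from differentiating the Gaussian is paid for by
      \<open>exp ?L\<close>, that is, by the summand 1 in the exponent of \<open>w\<close>.\<close>
    have "\<bar>z i\<bar> \<le> ?L" by (rule member_le_sum) auto
    moreover have "?L + 1 \<le> exp ?L" using exp_ge_add_one_self[of ?L] by (simp add: add.commute)
    ultimately have "\<bar>z i\<bar> + 1 \<le> exp ?L" by linarith
    moreover have "r * 1 \<le> R * exp ?L" using assms t by (intro mult_mono) (auto simp: sum_nonneg)
    ultimately show "r + \<bar>z i\<bar> / 2 \<le> (R + 1) * exp ?L" by (simp add: algebra_simps)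
  qed (use t C in auto)
  finally have "\<bar>r * dd i (pt r z) - z i / 2 * d i (pt r z)\<bar> \<le> ((R + 1) * exp ?L) * (C * exp (C * norm x) * exp (C * R * ?L))" .
  from mult_right_mono[OF this \<Phi>_nonneg[of z]] show ?thesis
    using \<Phi>_nonneg by (simp add: G'_def abs_mult A_def w_prod mult_ac)
qed

lemma w_nonneg: "w y \<ge> 0" by (simp add: w_def)

lemma integrable_w: "integrable lborel w"
  unfolding w_def by (rule integrable_exp_abs_gaussian)

lemma integrable_prod_w: "finite I \<Longrightarrow> integrable (Pi\<^sub>M I (\<lambda>_. lborel)) (\<lambda>z. \<Prod>i\<in>I. w (z i))"
  using product_sigma_finite.product_integrable_prod[OF product_sigma_finite_lborel, of I "\<lambda>_. w"] integrable_w by simp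

lemma measurable_on_S:
  fixes f :: "_ \<Rightarrow> real"
  assumes "continuous_on S f"
  shows "(\<lambda>p. indicator S p * f p) \<in> borel_measurable borel"
  using borel_measurable_continuous_on_indicator[OF _ assms] closed_S by simp

lemma measurable_pt: "(\<lambda>(r, z). pt r z) \<in> borel_measurable (lborel \<Otimes>\<^sub>M P)"
  unfolding pt_def by measurable

lemma measurable_E: "E i \<in> borel_measurable (lborel \<Otimes>\<^sub>M P)"
proof -
  have [measurable]: "(\<lambda>(r, z). indicator S (pt r z) * d i (pt r z)) \<in> borel_measurable (lborel \<Otimes>\<^sub>M P)"
    "(\<lambda>(r, z). indicator S (pt r z) * dd i (pt r z)) \<in> borel_measurable (lborel \<Otimes>\<^sub>M P)"
    using measurable_compose[OF measurable_pt measurable_on_S[OF cont(1)]]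
      measurable_compose[OF measurable_pt measurable_on_S[OF cont(2)]]
    by (simp_all add: case_prod_beta)
  \<comment> \<open>Nothing is known about \<open>d\<close> and \<open>dd\<close> outside
    \<open>S\<close>, so they are first multiplied by the indicator of \<open>S\<close>. This
    changes nothing, since the cutoffs in \<open>E\<close> already keep the curve in
    \<open>S\<close> by \<open>pt_in\<close>.\<close>
  have "E i = (\<lambda>(r, z). indicator {0..R} r * indicator {0..} (z last_index) *
      ((r * (indicator S (pt r z) * dd i (pt r z)) - z i / 2 * (indicator S (pt r z) * d i (pt r z))) * \<Phi> z))"
    using pt_in by (auto simp: E_def G'_def fun_eq_iff indicator_def)
  also have "\<dots> \<in> borel_measurable (lborel \<Otimes>\<^sub>M P)"
    unfolding \<Phi>_def by measurable
  finally show ?thesis .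
qed

lemma E_bound: "\<bar>E i (r, z)\<bar> \<le> (A * indicator {0..R} r) * (\<Prod>i\<in>UNIV. w (z i))"
proof (cases "r \<in> {0..R} \<and> z last_index \<ge> 0")
  case True
  then show ?thesis using G'_bound[of r z i] by (simp add: E_def)
next
  case False
  then have "E i (r, z) = 0" by (auto simp: E_def)
  moreover have "0 \<le> (A * indicator {0..R} r) * (\<Prod>i\<in>UNIV. w (z i))"
    using A_nonneg w_nonneg by (intro mult_nonneg_nonneg prod_nonneg) auto
  ultimately show ?thesis by simp
qed

sublocale pair_sigma_finite lborel P
proof -
  interpret product_sigma_finite "\<lambda>_. lborel :: real measure" by (rule product_sigma_finite_lborel)
  interpret finite_product_sigma_finite "\<lambda>_. lborel :: real measure" "UNIV :: 'n set" by standard simp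
  show "pair_sigma_finite lborel P" by standard
qed

lemma integrable_E: "integrable (lborel \<Otimes>\<^sub>M P) (E i)"
proof (rule integrable_pair_bound[OF measurable_E _ _ E_bound])
  show "integrable lborel (\<lambda>r. A * indicator {0..R} r)"
    using t by (intro integrable_mult_right) (simp add: integrable_indicator_iff)
qed (simp add: integrable_prod_w)

text \<open>Fubini would give this for almost every \<open>r\<close>; the majorant gives it for each
  \<open>r\<close>.\<close>

lemma integrable_E_slice: "integrable P (\<lambda>z. E i (r, z))"
proof (rule Bochner_Integration.integrable_bound)
  show "integrable P (\<lambda>z. (A * indicator {0..R} r) * (\<Prod>i\<in>UNIV. w (z i)))"
    by (intro integrable_mult_right integrable_prod_w) simp
  show "(\<lambda>z. E i (r, z)) \<in> borel_measurable P"
    using measurable_E by (rule measurable_compose[rotated]) measurable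
  show "AE z in P. norm (E i (r, z)) \<le> norm ((A * indicator {0..R} r) * (\<Prod>i\<in>UNIV. w (z i)))"
    by (intro AE_I2) (use E_bound[of i r] in \<open>auto intro: order_trans[OF _ abs_ge_self]\<close>)
qed

section \<open>Integration in the space variable, one coordinate at a time\<close>

lemma pt_upd: "pt r (z(i := y)) = (t - r\<^sup>2, (x + r *\<^sub>R vec_lambda (z(i := 0))) + (r * y) *\<^sub>R axis i 1)"
  by (simp only: pt_def vec_lambda_fun_upd[of z i y] scaleR_add_right add.assoc scaleR_scaleR)

lemma prod_upd:
  fixes h :: "real \<Rightarrow> real" and i :: 'n
  shows "(\<Prod>j\<in>UNIV. h ((z(i := y)) j)) = h y * (\<Prod>j\<in>UNIV - {i}. h (z j))"
  by (subst prod.remove[of _ i]) (auto intro!: prod.cong)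

lemma \<Phi>_upd: "\<Phi> (z(i := y)) = exp (- y\<^sup>2 / 4) * (\<Prod>j\<in>UNIV - {i}. exp (- (z j)\<^sup>2 / 4))"
  unfolding \<Phi>_def by (rule prod_upd)

text \<open>Moving \<open>z i\<close> moves the point along axis \<open>i\<close> at speed
  \<open>r\<close>, whence the term \<open>r * dd i\<close>; the Gaussian contributes - z i / 2. The
  set \<open>Y\<close> is the whole line in tangential directions and {0..} in the normal one, where
  the derivative at 0 is one-sided.\<close>

lemma G_deriv:
  assumes r: "r \<in> {0..R}" and Y: "\<And>y. y \<in> Y \<Longrightarrow> (z(i := y)) last_index \<ge> 0" and y: "y \<in> Y"
  shows "((\<lambda>y. G i r (z(i := y))) has_real_derivative G' i r (z(i := y))) (at y within Y)"
proof -
  define p where "p = snd (pt r (z(i := y)))"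
  have pt: "pt r (z(i := y')) = (t - r\<^sup>2, p + (r * (y' - y)) *\<^sub>R axis i 1)" for y'
    by (simp add: p_def pt_upd algebra_simps)
  have S: "pt r (z(i := y')) \<in> S" if "y' \<in> Y" for y' using pt_in[where z = "z(i := y')", OF r Y[OF that]] .
  have "((\<lambda>h. d i (t - r\<^sup>2, p + h *\<^sub>R axis i 1)) has_real_derivative dd i (t - r\<^sup>2, p))
      (at 0 within {h. p + h *\<^sub>R axis i 1 \<in> half_space})"
    using S[OF y] by (intro deriv_d) (simp_all add: pt)
  then have "((\<lambda>h. d i (t - r\<^sup>2, p + h *\<^sub>R axis i 1)) has_real_derivative dd i (t - r\<^sup>2, p))
      (at (r * (y - y)) within (\<lambda>y'. r * (y' - y)) ` Y)"
    using S by (auto simp: pt intro: DERIV_subset)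
  moreover have "((\<lambda>y'. r * (y' - y)) has_real_derivative r) (at y within Y)"
    by (auto intro!: derivative_eq_intros)
  ultimately have "((\<lambda>y'. d i (pt r (z(i := y')))) has_real_derivative dd i (pt r (z(i := y))) * r) (at y within Y)"
    using DERIV_image_chain by (fastforce simp: o_def pt)
  then show ?thesis
    unfolding G_def G'_def \<Phi>_upd by (auto intro!: derivative_eq_intros simp: algebra_simps)
qed

lemma G'_cont:
  assumes r: "r \<in> {0..R}" and Y: "\<And>y. y \<in> Y \<Longrightarrow> (z(i := y)) last_index \<ge> 0"
  shows "continuous_on Y (\<lambda>y. G' i r (z(i := y)))"
proof -
  have "continuous_on Y (\<lambda>y. pt r (z(i := y)))"
    unfolding pt_upd by (intro continuous_intros)
  then have "continuous_on Y (\<lambda>y. f (pt r (z(i := y))))" if "continuous_on S f" for f :: "_ \<Rightarrow> real"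
    by (rule continuous_on_compose2[OF that]) (use pt_in[where z = "z(i := y)" for y, OF r Y] in blast)
  from this[OF cont(1)] this[OF cont(2)] show ?thesis
    unfolding G'_def \<Phi>_upd fun_upd_same by (intro continuous_intros) auto
qed

lemma E_line_bound: "\<bar>E i (r, z(i := y))\<bar> \<le> A * (\<Prod>j\<in>UNIV - {i}. w (z j)) * w y"
proof -
  have "\<bar>E i (r, z(i := y))\<bar> \<le> (A * indicator {0..R} r) * (\<Prod>j\<in>UNIV. w ((z(i := y)) j))"
    by (rule E_bound)
  also have "\<dots> \<le> (A * 1) * (\<Prod>j\<in>UNIV. w ((z(i := y)) j))"
    using A_nonneg w_nonneg by (intro mult_right_mono mult_left_mono prod_nonneg) (auto simp: indicator_def)
  also have "(\<Prod>j\<in>UNIV. w ((z(i := y)) j)) = w y * (\<Prod>j\<in>UNIV - {i}. w (z j))" by (rule prod_upd)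
  finally show ?thesis by (simp add: mult_ac del: fun_upd_apply)
qed

lemma integrable_E_line:
  assumes "(\<lambda>y. E i (r, z(i := y))) \<in> borel_measurable borel"
  shows "integrable lborel (\<lambda>y. E i (r, z(i := y)))"
proof (rule Bochner_Integration.integrable_bound)
  show "integrable lborel (\<lambda>y. A * (\<Prod>j\<in>UNIV - {i}. w (z j)) * w y)"
    using integrable_w by (rule integrable_mult_right)
  show "AE y in lborel. norm (E i (r, z(i := y))) \<le> norm (A * (\<Prod>j\<in>UNIV - {i}. w (z j)) * w y)"
    using E_line_bound[of i r z] by (intro AE_I2) (auto intro: order_trans[OF _ abs_ge_self])
qed (use assms in simp)

lemma w_lim: "(w \<longlongrightarrow> 0) at_top" "(w \<longlongrightarrow> 0) at_bot"
  unfolding w_def by (rule tendsto_exp_abs_gaussian)+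

text \<open>The filter stands for \<open>at_top\<close> or \<open>at_bot\<close>: the Gaussian decay
  of \<open>w\<close> beats the growth of \<open>d i\<close>.\<close>

lemma G_lim:
  assumes r: "r \<in> {0..R}" and F: "\<forall>\<^sub>F y in F. (z(i := y)) last_index \<ge> 0" "(w \<longlongrightarrow> 0) F"
  shows "((\<lambda>y. G i r (z(i := y))) \<longlongrightarrow> 0) F"
proof (rule Lim_null_comparison)
  show "\<forall>\<^sub>F y in F. norm (G i r (z(i := y))) \<le> A * (w y * (\<Prod>j\<in>UNIV - {i}. w (z j)))"
    using F(1) by eventually_elim (use G_bound[OF r] in \<open>simp add: prod_upd[symmetric] del: fun_upd_apply\<close>)
  show "((\<lambda>y. A * (w y * (\<Prod>j\<in>UNIV - {i}. w (z j)))) \<longlongrightarrow> 0) F"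
    using F(2) by (intro tendsto_mult_right_zero tendsto_mult_left_zero)
qed

text \<open>A tangential line lies entirely inside or entirely outside the half space. Inside, the
  integrand is the derivative of a function vanishing at both ends; outside, it is zero.\<close>

lemma integral_E_line_tangential:
  assumes "i \<noteq> last_index"
  shows "(LINT y|lborel. E i (r, z(i := y))) = 0"
proof (cases "r \<in> {0..R} \<and> z last_index \<ge> 0")
  case True
  then have r: "r \<in> {0..R}" and z: "\<And>y. (z(i := y)) last_index \<ge> 0" using assms by auto
  have E: "E i (r, z(i := y)) = G' i r (z(i := y))" for y
    using r z[of y] by (simp add: E_def del: fun_upd_apply)
  have cont: "continuous_on UNIV (\<lambda>y. G' i r (z(i := y)))" by (rule G'_cont[OF r z])
  show ?thesis
    unfolding E
  proof (rule integral_derivative_whole_line[where F = "\<lambda>y. G i r (z(i := y))", OF _ cont])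
    show "integrable lborel (\<lambda>y. G' i r (z(i := y)))"
      using integrable_E_line[of i r z] borel_measurable_continuous_onI[OF cont] unfolding E by simp
  qed (use G_deriv[where Y = UNIV, OF r z] w_lim z in \<open>auto intro!: G_lim[OF r] simp del: fun_upd_apply\<close>)
next
  case False
  then show ?thesis using assms by (auto simp: E_def)
qed

text \<open>The normal line meets the half space in a half line, so the value at its endpoint
  survives: this is the source of the boundary flux.\<close>

lemma integral_E_line_normal:
  "(LINT y|lborel. E last_index (r, z(last_index := y))) = - indicator {0..R} r * G last_index r (z(last_index := 0))"
proof (cases "r \<in> {0..R}")
  case r: True
  have E: "E last_index (r, z(last_index := y)) = indicator {0..} y * G' last_index r (z(last_index := y))" for y
    using r by (simp add: E_def)
  have cont: "continuous_on {0..} (\<lambda>y. G' last_index r (z(last_index := y)))" by (rule G'_cont[OF r]) simp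
  have "(LINT y|lborel. indicator {0..} y * G' last_index r (z(last_index := y))) = - G last_index r (z(last_index := 0))"
  proof (rule integral_derivative_half_line[OF _ cont])
    show "integrable lborel (\<lambda>y. indicator {0..} y * G' last_index r (z(last_index := y)))"
    proof -
      have "(\<lambda>y. indicator {0..} y *\<^sub>R G' last_index r (z(last_index := y))) \<in> borel_measurable borel"
        by (rule borel_measurable_continuous_on_indicator[OF _ cont]) simp
      then have "integrable lborel (\<lambda>y. E last_index (r, z(last_index := y)))"
        by (intro integrable_E_line) (simp only: E real_scaleR_def)
      then show ?thesis by (simp only: E)
    qed
    show "((\<lambda>y. G last_index r (z(last_index := y))) \<longlongrightarrow> 0) at_top"
      using w_lim by (intro G_lim[OF r]) (simp_all add: eventually_ge_at_top)
  qed (rule G_deriv[OF r], auto)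
  then show ?thesis unfolding E using r by simp
next
  case False
  then show ?thesis by (simp add: E_def)
qed

text \<open>Fubini with coordinate \<open>i\<close> innermost, the one in which \<open>E i\<close>
  is a derivative.\<close>

lemma integral_E_slice:
  "(LINT z|P. E i (r, z)) = (LINT z|Pi\<^sub>M (UNIV - {i}) (\<lambda>_. lborel). LINT y|lborel. E i (r, z(i := y)))"
proof -
  interpret product_sigma_finite "\<lambda>_. lborel :: real measure" by (rule product_sigma_finite_lborel)
  have "insert i (UNIV - {i}) = (UNIV :: 'n set)" by auto
  with product_integral_insert[of "UNIV - {i}" i "\<lambda>z. E i (r, z)"] integrable_E_slice[of i r]
  show ?thesis by simp
qed

lemma integral_E_tangential: "i \<noteq> last_index \<Longrightarrow> (LINT z|P. E i (r, z)) = 0"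
  unfolding integral_E_slice by (simp add: integral_E_line_tangential)

lemma integral_E_normal:
  "(LINT z|P. E last_index (r, z)) = - indicator {0..R} r * (LINT z|Q. G last_index r (z(last_index := 0)))"
  unfolding integral_E_slice integral_E_line_normal by simp

section \<open>Integration along the curves and the resulting representation\<close>

text \<open>By the chain rule the time component contributes - 2 r times the sum of the
  \<open>dd i\<close>, the heat equation being part of \<open>deriv_v\<close>, and the space
  component contributes the sum of \<open>z i * d i\<close>. Multiplied by \<Phi>, these are - 2
  times the sum of the \<open>G' i\<close>.\<close>

lemma v_along_curve:
  assumes z: "z last_index \<ge> 0" and r: "r \<in> {0..R}"
  shows "((\<lambda>r. v (pt r z) * \<Phi> z) has_real_derivative - 2 * (\<Sum>i\<in>UNIV. G' i r z)) (at r within {0..R})"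
proof -
  have pt: "((\<lambda>r. pt r z) has_derivative (\<lambda>h. (- (2 * r * h), h *\<^sub>R vec_lambda z))) (at r within {0..R})"
    unfolding pt_def by (auto intro!: derivative_eq_intros)
  have "(v has_derivative (\<lambda>(h, k). h * (\<Sum>i\<in>UNIV. dd i (pt r z)) + (\<Sum>i\<in>UNIV. k $ i * d i (pt r z))))
      (at (pt r z) within (\<lambda>r. pt r z) ` {0..R})"
    by (rule has_derivative_subset[OF deriv_v]) (use pt_in[where z = z, OF _ z] r in blast)+
  from has_derivative_in_compose[OF pt this]
  have "((\<lambda>r. v (pt r z)) has_derivative (\<lambda>h. - (2 * r * h) * (\<Sum>i\<in>UNIV. dd i (pt r z)) +
      (\<Sum>i\<in>UNIV. h * z i * d i (pt r z)))) (at r within {0..R})"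
    by simp
  also have "(\<lambda>h. - (2 * r * h) * (\<Sum>i\<in>UNIV. dd i (pt r z)) + (\<Sum>i\<in>UNIV. h * z i * d i (pt r z))) =
      (*) (\<Sum>i\<in>UNIV. z i * d i (pt r z) - 2 * r * dd i (pt r z))"
    by (simp add: fun_eq_iff sum_subtractf sum_distrib_left sum_distrib_right sum_negf algebra_simps)
  finally have "((\<lambda>r. v (pt r z)) has_real_derivative (\<Sum>i\<in>UNIV. z i * d i (pt r z) - 2 * r * dd i (pt r z))) (at r within {0..R})"
    by (simp add: has_field_derivative_def)
  from DERIV_cmult_right[OF this, of "\<Phi> z"] show ?thesis
    by (rule DERIV_cong) (simp add: G'_def sum_distrib_left sum_distrib_right algebra_simps)
qed

text \<open>At r = \<open>R\<close> the curve has reached time 0, where \<open>v\<close> vanishes;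
  at r = 0 every curve sits at (t, x).\<close>

lemma integral_E_curve:
  assumes z: "z last_index \<ge> 0"
  shows "(LINT r|lborel. (\<Sum>i\<in>UNIV. E i (r, z))) = v (t, x) * \<Phi> z / 2"
proof -
  have "(LINT r|lborel. indicator {0..R} r *\<^sub>R (- 2 * (\<Sum>i\<in>UNIV. G' i r z))) = v (pt R z) * \<Phi> z - v (pt 0 z) * \<Phi> z"
  proof (rule integral_FTC_Icc)
    show "((\<lambda>r. v (pt r z) * \<Phi> z) has_vector_derivative - 2 * (\<Sum>i\<in>UNIV. G' i r z)) (at r within {0..R})"
      if "0 \<le> r" "r \<le> R" for r
      using v_along_curve[where z = z and r = r, OF z] that by (simp add: has_real_derivative_iff_has_vector_derivative)
    have "continuous_on {0..R} (\<lambda>r. pt r z)" unfolding pt_def by (intro continuous_intros)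
    then have "continuous_on {0..R} (\<lambda>r. f (pt r z))" if "continuous_on S f" for f :: "_ \<Rightarrow> real"
      by (rule continuous_on_compose2[OF that]) (use pt_in z in blast)
    from this[OF cont(1)] this[OF cont(2)] show "continuous_on {0..R} (\<lambda>r. - 2 * (\<Sum>i\<in>UNIV. G' i r z))"
      unfolding G'_def by (intro continuous_intros)
  qed (use t in simp)
  also have "v (pt R z) = 0"
    using pt_in[of R z] z t by (simp add: pt_def initial)
  also have "pt 0 z = (t, x)" by (simp add: pt_def)
  also have "(\<lambda>r. indicator {0..R} r *\<^sub>R (- 2 * (\<Sum>i\<in>UNIV. G' i r z))) = (\<lambda>r. - 2 * (\<Sum>i\<in>UNIV. E i (r, z)))"
    using z by (simp add: E_def sum_distrib_left fun_eq_iff)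
  finally show ?thesis by simp
qed

lemma integral_half_gaussian:
  "(LINT z|P. indicator {0..} (z last_index) * \<Phi> z) = sqrt (4 * pi) ^ CARD('n) / 2"
proof -
  interpret product_sigma_finite "\<lambda>_. lborel :: real measure" by (rule product_sigma_finite_lborel)
  \<comment> \<open>The indicator is put into the factor of the last coordinate, which turns the
    integrand into a product of functions of one variable.\<close>
  define f where "f = (\<lambda>i (y :: real). (if i = (last_index :: 'n) then indicator {0..} y else 1) * exp (- y\<^sup>2 / 4))"
  have g: "integrable lborel (\<lambda>y::real. exp (- y\<^sup>2 / 4))"
    using integrable_exp_abs_gaussian[of 0] by simp
  have f: "integrable lborel (f i)" for i
    using g integrable_mult_indicator[OF _ g, of "{0..}"] by (cases "i = last_index") (auto simp: f_def)
  have "(\<Prod>i\<in>UNIV. f i (z i)) = indicator {0..} (z last_index) * \<Phi> z" for z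
    by (simp add: f_def \<Phi>_def prod.distrib prod.delta)
  with product_integral_prod[of UNIV f] f
  have "(LINT z|P. indicator {0..} (z last_index) * \<Phi> z) = (\<Prod>i\<in>UNIV. integral\<^sup>L lborel (f i))"
    by simp
  also have "\<dots> = integral\<^sup>L lborel (f last_index) * (\<Prod>i\<in>UNIV - {last_index}. integral\<^sup>L lborel (f i))"
    by (rule prod.remove) auto
  also have "\<dots> = sqrt pi * (\<Prod>i\<in>UNIV - {last_index :: 'n}. sqrt (4 * pi))"
    using gaussian_integral_quarter by (simp add: f_def)
  also have "\<dots> = sqrt pi * sqrt (4 * pi) ^ (CARD('n) - 1)"
    by (simp add: card_Diff_singleton)
  also have "sqrt pi = sqrt (4 * pi) / 2" by (simp add: real_sqrt_mult)
  also have "sqrt (4 * pi) / 2 * sqrt (4 * pi) ^ (CARD('n) - 1) = sqrt (4 * pi) ^ CARD('n) / 2"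
    by (metis (no_types, lifting) One_nat_def Suc_pred times_divide_eq_left power_Suc zero_less_card_finite)
  finally show ?thesis .
qed

text \<open>Fubini for the sum of the \<open>E i\<close>. Integrating first in \<open>r\<close>
  gives v (t, x) / 2 times the half-space Gaussian integral, which carries another factor 1 / 2,
  hence the 4; integrating first in \<open>z\<close> leaves the flux.\<close>

theorem boundary_representation:
  "v (t, x) * sqrt (4 * pi) ^ CARD('n) =
    4 * (LINT r|lborel. indicator {0..R} r * (LINT z|Q. - G last_index r (z(last_index := 0))))"
proof -
  have int: "integrable (lborel \<Otimes>\<^sub>M P) (\<lambda>p. \<Sum>i\<in>UNIV. E i p)"
    by (intro Bochner_Integration.integrable_sum integrable_E)
  have curve: "(LINT r|lborel. (\<Sum>i\<in>UNIV. E i (r, z))) = v (t, x) / 2 * (indicator {0..} (z last_index) * \<Phi> z)" for z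
  proof (cases "z last_index \<ge> 0")
    case False
    then show ?thesis by (simp add: E_def)
  qed (simp add: integral_E_curve)
  have slice: "(LINT z|P. (\<Sum>i\<in>UNIV. E i (r, z))) = indicator {0..R} r * (LINT z|Q. - G last_index r (z(last_index := 0)))" for r
  proof -
    have "(LINT z|P. (\<Sum>i\<in>UNIV. E i (r, z))) = (\<Sum>i\<in>UNIV. LINT z|P. E i (r, z))"
      by (intro Bochner_Integration.integral_sum integrable_E_slice)
    also have "\<dots> = (LINT z|P. E last_index (r, z)) + (\<Sum>i\<in>UNIV - {last_index}. LINT z|P. E i (r, z))"
      by (rule sum.remove) auto
    finally show ?thesis by (simp add: integral_E_tangential integral_E_normal)
  qed
  have "(LINT r|lborel. indicator {0..R} r * (LINT z|Q. - G last_index r (z(last_index := 0)))) =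
      (LINT r|lborel. LINT z|P. (\<Sum>i\<in>UNIV. E i (r, z)))"
    by (simp only: slice)
  also have "\<dots> = (LINT z|P. LINT r|lborel. (\<Sum>i\<in>UNIV. E i (r, z)))"
    using int by (intro Fubini_integral[symmetric]) (simp add: split_def)
  also have "\<dots> = v (t, x) / 2 * (sqrt (4 * pi) ^ CARD('n) / 2)"
    by (simp only: curve integral_mult_right_zero integral_half_gaussian)
  finally show ?thesis by simp
qed

end

subsection \<open>Boundary coordinates and the time substitution\<close>

text \<open>Reflect s = t - \<sigma>, then put \<sigma> = r^2: the weight 1 / r cancels the r in
  d\<sigma> = 2 r dr. Integrability comes from the majorant M \<sigma>^(- 1 / 2).\<close>

lemma set_integral_substitution_sqrt:
  fixes B :: "real \<Rightarrow> real"
  assumes [measurable]: "B \<in> borel_measurable borel"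
    and bound: "\<And>r. \<bar>B r\<bar> \<le> M" and t: "t \<ge> 0"
  shows "set_integrable lborel {0..t} (\<lambda>s. B (sqrt (t - s)) / sqrt (t - s))"
    and "(LBINT s:{0..t}. B (sqrt (t - s)) / sqrt (t - s)) = 2 * (LINT r|lborel. indicator {0..sqrt t} r * B r)"
proof -
  define f where "f \<sigma> = B (sqrt \<sigma>) / sqrt \<sigma>" for \<sigma>
  have [measurable]: "f \<in> borel_measurable borel" unfolding f_def by measurable
  have "(\<lambda>\<sigma>. \<sigma> powr (- 1 / 2)) absolutely_integrable_on {0..t}"
    using t by (subst absolutely_integrable_on_iff_nonneg) (auto intro!: integrable_on_powr_from_0)
  then have "integrable lborel (\<lambda>\<sigma>. indicator {0..t} \<sigma> *\<^sub>R \<sigma> powr (- 1 / 2))"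
    unfolding set_integrable_def by (subst (asm) integrable_completion) auto
  then have "integrable lborel (\<lambda>\<sigma>. M * (indicator {0..t} \<sigma> *\<^sub>R \<sigma> powr (- 1 / 2)))"
    by (rule integrable_mult_right)
  then have f: "integrable lborel (\<lambda>\<sigma>. indicator {0..t} \<sigma> *\<^sub>R f \<sigma>)"
  proof (rule Bochner_Integration.integrable_bound)
    have "M \<ge> 0" using bound[of 0] by simp
    have "norm (f \<sigma>) \<le> M * \<sigma> powr (- 1 / 2)" if "\<sigma> \<ge> 0" for \<sigma>
    proof -
      have "\<sigma> powr (- 1 / 2) = 1 / sqrt \<sigma>"
        using powr_minus_divide[of \<sigma> "1 / 2"] that by (simp add: powr_half_sqrt)
      then show ?thesis using bound[of "sqrt \<sigma>"] that by (simp add: f_def divide_right_mono)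
    qed
    with \<open>M \<ge> 0\<close> show "AE \<sigma> in lborel. norm (indicator {0..t} \<sigma> *\<^sub>R f \<sigma>) \<le> norm (M * (indicator {0..t} \<sigma> *\<^sub>R \<sigma> powr (- 1 / 2)))"
      by (intro AE_I2) (auto simp: indicator_def)
  qed measurable
  have refl: "indicator {0..t} (t + - 1 * s) *\<^sub>R f (t + - 1 * s) = indicator {0..t} s *\<^sub>R (B (sqrt (t - s)) / sqrt (t - s))" for s
    by (auto simp: f_def indicator_def)
  show "set_integrable lborel {0..t} (\<lambda>s. B (sqrt (t - s)) / sqrt (t - s))"
    using lborel_integrable_real_affine[OF f, of "- 1" t] unfolding set_integrable_def refl by simp
  have sub: "(LBINT \<sigma>. f \<sigma> * indicator {0\<^sup>2..(sqrt t)\<^sup>2} \<sigma>) = (LBINT r. f (r\<^sup>2) * (2 * r) * indicator {0..sqrt t} r)"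
  proof (rule integral_substitution)
    show "set_integrable lborel {0\<^sup>2..(sqrt t)\<^sup>2} f"
      using f t by (simp add: set_integrable_def)
  qed (use t in \<open>auto intro!: derivative_eq_intros continuous_intros\<close>)
  have "(LBINT s:{0..t}. B (sqrt (t - s)) / sqrt (t - s)) = (LBINT \<sigma>. indicator {0..t} \<sigma> *\<^sub>R f \<sigma>)"
    using lborel_integral_real_affine[of "- 1" "\<lambda>\<sigma>. indicator {0..t} \<sigma> *\<^sub>R f \<sigma>" t]
    unfolding set_lebesgue_integral_def refl by simp
  also have "\<dots> = (LBINT r. f (r\<^sup>2) * (2 * r) * indicator {0..sqrt t} r)"
    using sub t by (simp add: mult.commute)
  also have "\<dots> = (LBINT r. 2 * (indicator {0..sqrt t} r * B r))"
  \<comment> \<open>The integrands may differ at r = 0, where division by zero makes the left one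
    vanish.\<close>
  proof (rule integral_cong_AE)
    show "AE r in lborel. f (r\<^sup>2) * (2 * r) * indicator {0..sqrt t} r = 2 * (indicator {0..sqrt t} r * B r)"
      using AE_lborel_singleton[of 0] by (rule eventually_mono) (auto simp: f_def indicator_def)
  qed measurable
  finally show "(LBINT s:{0..t}. B (sqrt (t - s)) / sqrt (t - s)) = 2 * (LINT r|lborel. indicator {0..sqrt t} r * B r)"
    by simp
qed

section \<open>The boundary kernel in rescaled coordinates\<close>

abbreviation boundary_coords :: "('n::{finite,linorder} \<Rightarrow> real) measure" where
  "boundary_coords \<equiv> Pi\<^sub>M (UNIV - {last_index}) (\<lambda>_. lborel)"

text \<open>The weight \<Phi> restricted to the boundary; for n = 1 it is the empty product
  1.\<close>

definition boundary_gauss :: "('n::{finite,linorder} \<Rightarrow> real) \<Rightarrow> real" where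
  "boundary_gauss z = (\<Prod>i\<in>UNIV - {last_index}. exp (- (z i)\<^sup>2 / 4))"

text \<open>The displacement has squared length \<tau> |z|^2, so \<tau> cancels in the exponent and
  survives only in the normalization \<tau>^(- n / 2).\<close>

lemma boundary_kernel_scaled:
  fixes x :: "real ^ 'n::{finite,linorder}"
  assumes "\<tau> > 0"
  shows "boundary_kernel \<tau> x (x + sqrt \<tau> *\<^sub>R boundary_embed z) =
    2 / (sqrt (4 * pi) ^ CARD('n) * sqrt \<tau> ^ CARD('n)) * boundary_gauss z"
proof -
  have "(norm (sqrt \<tau> *\<^sub>R (boundary_embed z :: (real, 'n) vec)))\<^sup>2 = \<tau> * (\<Sum>i\<in>UNIV. (boundary_embed z $ i :: real)\<^sup>2)"
  proof -
    have "(norm (boundary_embed z :: (real, 'n) vec))\<^sup>2 = (\<Sum>i\<in>UNIV. (boundary_embed z $ i :: real)\<^sup>2)"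
      unfolding power2_norm_eq_inner inner_vec_def by (simp add: power2_eq_square)
    then show ?thesis using assms by (simp add: power_mult_distrib)
  qed
  also have "(\<Sum>i\<in>UNIV. (boundary_embed z $ i :: real)\<^sup>2) = (\<Sum>i\<in>UNIV - {last_index :: 'n}. (z i)\<^sup>2)"
    by (subst sum.remove[of _ last_index]) (auto simp: boundary_embed_def intro!: sum.cong)
  finally have "exp (- (norm (x - (x + sqrt \<tau> *\<^sub>R (boundary_embed z :: (real, 'n) vec))))\<^sup>2 / (4 * \<tau>)) = boundary_gauss z"
    using assms by (simp add: boundary_gauss_def exp_sum[symmetric] sum_negf sum_divide_distrib)
  moreover have "(4 * pi * \<tau>) powr (real CARD('n) / 2) = sqrt (4 * pi) ^ CARD('n) * sqrt \<tau> ^ CARD('n)"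
  proof -
    have "(4 * pi * \<tau>) powr (real CARD('n) / 2) = ((4 * pi * \<tau>) powr (1 / 2)) powr real CARD('n)"
      by (simp add: powr_powr)
    also have "\<dots> = sqrt (4 * pi * \<tau>) ^ CARD('n)"
      using assms by (simp add: powr_half_sqrt powr_realpow)
    finally show ?thesis by (simp add: real_sqrt_mult power_mult_distrib)
  qed
  ultimately show ?thesis by (simp add: boundary_kernel_def)
qed

text \<open>Substitute y = x + \<open>sqrt \<tau>\<close> z in the n - 1 boundary coordinates. The
  Jacobian has n - 1 factors \<open>sqrt \<tau>\<close> and the kernel has n of them in its
  denominator, so a single one remains there.\<close>

lemma boundary_measure_kernel:
  fixes x :: "real ^ 'n::{finite,linorder}" and f :: "real ^ 'n::{finite,linorder} \<Rightarrow> real"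
  assumes f: "f \<in> borel_measurable (restrict_space borel half_space_boundary)"
    and \<tau>: "\<tau> > 0" and x: "x \<in> half_space_boundary"
  shows "integrable boundary_measure (\<lambda>y. f y * boundary_kernel \<tau> x y) \<longleftrightarrow>
      integrable boundary_coords (\<lambda>z. f (x + sqrt \<tau> *\<^sub>R boundary_embed z) * boundary_gauss z)"
    and "(LINT y|boundary_measure. f y * boundary_kernel \<tau> x y) =
      2 / (sqrt (4 * pi) ^ CARD('n) * sqrt \<tau>) * (LINT z|boundary_coords. f (x + sqrt \<tau> *\<^sub>R boundary_embed z) * boundary_gauss z)"
proof -
  let ?I = "UNIV - {last_index :: 'n}" and ?c = "sqrt \<tau>"
  let ?Q = "boundary_coords :: ('n \<Rightarrow> real) measure"
  define m where "m = card ?I"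
  define \<phi> where "\<phi> z = (\<lambda>i\<in>?I. x $ i + ?c * z i)" for z
  define h where "h z = f (boundary_embed z) * boundary_kernel \<tau> x (boundary_embed z)" for z
  have [measurable]: "\<phi> \<in> ?Q \<rightarrow>\<^sub>M ?Q" unfolding \<phi>_def by measurable
  have kernel: "(\<lambda>y. f y * boundary_kernel \<tau> x y) \<in> borel_measurable (restrict_space borel half_space_boundary)"
  proof (rule borel_measurable_times[OF f measurable_restrict_space1])
    show "boundary_kernel \<tau> x \<in> borel_measurable borel" unfolding boundary_kernel_def[abs_def] by measurable
  qed
  then have h[measurable]: "h \<in> borel_measurable ?Q"
    unfolding h_def by (rule measurable_compose[OF measurable_boundary_embed])
  \<comment> \<open>The affine map of coordinates corresponds to the one on the boundary because the
    last coordinate of \<open>x\<close> is 0.\<close>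
  have embed: "boundary_embed (\<phi> z) = x + ?c *\<^sub>R boundary_embed z" for z
    using x by (simp add: boundary_embed_def \<phi>_def vec_eq_iff half_space_boundary_def)
  have Q: "?Q = density (distr ?Q ?Q \<phi>) (\<lambda>_. ennreal (?c ^ m))"
    unfolding \<phi>_def m_def using \<tau> by (intro PiM_lborel_affine) auto
  define k where "k = 2 / (sqrt (4 * pi) ^ CARD('n) * ?c)"
  have "k > 0" using \<tau> by (simp add: k_def)
  have CARD: "CARD('n) = Suc (m)"
    unfolding m_def by (rule card.remove) auto
  have hk: "?c ^ m * h (\<phi> z) = k * (f (x + ?c *\<^sub>R boundary_embed z) * boundary_gauss z)" for z
    using \<tau> by (simp add: h_def embed boundary_kernel_scaled k_def CARD mult_ac)
  have "integrable boundary_measure (\<lambda>y. f y * boundary_kernel \<tau> x y) \<longleftrightarrow> integrable ?Q h"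
    unfolding boundary_measure_def h_def by (rule integrable_distr_eq[OF measurable_boundary_embed kernel])
  also have "\<dots> \<longleftrightarrow> integrable ?Q (\<lambda>z. ?c ^ m * h (\<phi> z))"
  proof -
    have "integrable ?Q h \<longleftrightarrow> integrable (density (distr ?Q ?Q \<phi>) (\<lambda>_. ennreal (?c ^ m))) h"
      by (rule arg_cong[where f = "\<lambda>M. integrable M h", OF Q])
    also have "\<dots> \<longleftrightarrow> integrable (distr ?Q ?Q \<phi>) (\<lambda>z. ?c ^ m *\<^sub>R h z)"
      using \<tau> h by (intro integrable_density) auto
    also have "\<dots> \<longleftrightarrow> integrable ?Q (\<lambda>z. ?c ^ m *\<^sub>R h (\<phi> z))"
      by (rule integrable_distr_eq) measurable
    finally show ?thesis by simp
  qed
  also have "\<dots> \<longleftrightarrow> integrable ?Q (\<lambda>z. f (x + ?c *\<^sub>R boundary_embed z) * boundary_gauss z)"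
    unfolding hk using \<open>k > 0\<close> by simp
  finally show "integrable boundary_measure (\<lambda>y. f y * boundary_kernel \<tau> x y) \<longleftrightarrow>
      integrable boundary_coords (\<lambda>z. f (x + sqrt \<tau> *\<^sub>R boundary_embed z) * boundary_gauss z)" .
  have "(LINT y|boundary_measure. f y * boundary_kernel \<tau> x y) = (LINT z|?Q. h z)"
    unfolding boundary_measure_def h_def by (rule integral_distr[OF measurable_boundary_embed kernel])
  also have "\<dots> = (LINT z|?Q. ?c ^ m * h (\<phi> z))"
  proof -
    have "(LINT z|?Q. h z) = (LINT z|density (distr ?Q ?Q \<phi>) (\<lambda>_. ennreal (?c ^ m)). h z)"
      by (rule arg_cong[where f = "\<lambda>M. integral\<^sup>L M h", OF Q])
    also have "\<dots> = (LINT z|distr ?Q ?Q \<phi>. ?c ^ m *\<^sub>R h z)"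
      using \<tau> h by (intro integral_density) auto
    also have "\<dots> = (LINT z|?Q. ?c ^ m *\<^sub>R h (\<phi> z))"
      by (rule integral_distr) measurable
    finally show ?thesis by simp
  qed
  also have "\<dots> = k * (LINT z|?Q. f (x + ?c *\<^sub>R boundary_embed z) * boundary_gauss z)"
    unfolding hk by simp
  finally show "(LINT y|boundary_measure. f y * boundary_kernel \<tau> x y) =
      2 / (sqrt (4 * pi) ^ CARD('n) * sqrt \<tau>) * (LINT z|boundary_coords. f (x + sqrt \<tau> *\<^sub>R boundary_embed z) * boundary_gauss z)"
    unfolding k_def .
qed

text \<open>There are n - 1 factors \<open>sqrt (4 * pi)\<close>; the quotient form cancels directly
  against the constant of \<open>boundary_measure_kernel\<close> and yields the kernel mass 1 / sqrt
  (pi \<tau>).\<close>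

lemma boundary_gauss_integral:
  "integrable boundary_coords (boundary_gauss :: ('n::{finite,linorder} \<Rightarrow> real) \<Rightarrow> real)"
  "(LINT z|boundary_coords. boundary_gauss (z :: 'n::{finite,linorder} \<Rightarrow> real)) = sqrt (4 * pi) ^ CARD('n) / sqrt (4 * pi)"
proof -
  interpret product_sigma_finite "\<lambda>_. lborel :: real measure" by (rule product_sigma_finite_lborel)
  have g: "integrable lborel (\<lambda>y::real. exp (- y\<^sup>2 / 4))"
    using integrable_exp_abs_gaussian[of 0] by simp
  show "integrable boundary_coords (boundary_gauss :: ('n::{finite,linorder} \<Rightarrow> real) \<Rightarrow> real)"
    using product_integrable_prod[of "UNIV - {last_index :: 'n}" "\<lambda>_ y. exp (- y\<^sup>2 / 4)"] g
    by (simp add: boundary_gauss_def[abs_def])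
  have "(LINT z|boundary_coords. boundary_gauss (z :: 'n::{finite,linorder} \<Rightarrow> real)) = sqrt (4 * pi) ^ card (UNIV - {last_index :: 'n})"
    using product_integral_prod[of "UNIV - {last_index :: 'n}" "\<lambda>_ y. exp (- y\<^sup>2 / 4)"] g
    by (simp add: boundary_gauss_def[abs_def] gaussian_integral_quarter(1)[simplified])
  also have "\<dots> = sqrt (4 * pi) ^ CARD('n) / sqrt (4 * pi)"
  proof -
    have CARD: "CARD('n) = Suc (card (UNIV - {last_index :: 'n}))" by (rule card.remove) auto
    have "sqrt (4 * pi) \<noteq> 0" by simp
    from nonzero_mult_div_cancel_left[OF this] show ?thesis unfolding CARD power_Suc by (rule sym)
  qed
  finally show "(LINT z|boundary_coords. boundary_gauss (z :: 'n::{finite,linorder} \<Rightarrow> real)) = sqrt (4 * pi) ^ CARD('n) / sqrt (4 * pi)" .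
qed

section \<open>From the representation of the solution to the flux formula\<close>

context half_space_heat
begin

text \<open>The Gaussian average of the flux at time t - r^2. The cutoff in \<open>r\<close> makes
  it measurable and bounded on the whole line, as the time substitution requires.\<close>

definition B :: "real \<Rightarrow> real" where
  "B r = (LINT z|Q. - (indicator {0..R} r * G last_index r (z(last_index := 0))))"

lemma G_boundary:
  "G last_index r (z(last_index := 0)) = d last_index (t - r\<^sup>2, x + r *\<^sub>R boundary_embed z) * boundary_gauss z"
proof -
  have "vec_lambda (z(last_index := 0)) = (boundary_embed z :: (real, 'n) vec)"
    by (simp add: boundary_embed_def vec_eq_iff)
  then show ?thesis by (simp add: G_def \<Phi>_upd pt_def boundary_gauss_def)
qed

lemma boundary_point_in: "x + r *\<^sub>R boundary_embed z \<in> half_space_boundary"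
  using x by (simp add: half_space_boundary_def boundary_embed_def)

lemma boundary_subset: "(half_space_boundary :: (real, 'n) vec set) \<subseteq> half_space"
  by (auto simp: half_space_boundary_def half_space_def)

lemma measurable_G_boundary:
  "(\<lambda>(r, z). - (indicator {0..R} r * G last_index r (z(last_index := 0)))) \<in> borel_measurable (lborel \<Otimes>\<^sub>M Q)"
proof -
  have [measurable]: "(boundary_embed :: _ \<Rightarrow> (real, 'n) vec) \<in> borel_measurable Q"
    using measurable_boundary_embed[where ?'n = 'n] by (simp add: measurable_restrict_space2_iff)
  have [measurable]: "boundary_gauss \<in> borel_measurable Q"
    unfolding boundary_gauss_def[abs_def] by measurable
  have "(\<lambda>(r, z). (t - r\<^sup>2, x + r *\<^sub>R boundary_embed z)) \<in> borel_measurable (lborel \<Otimes>\<^sub>M Q)"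
    by measurable
  from measurable_compose[OF this measurable_on_S[OF cont(1)], of last_index]
  have [measurable]: "(\<lambda>(r, z). indicator S (t - r\<^sup>2, x + r *\<^sub>R boundary_embed z) *
      d last_index (t - r\<^sup>2, x + r *\<^sub>R boundary_embed z)) \<in> borel_measurable (lborel \<Otimes>\<^sub>M Q)"
    by (simp add: split_def)
  have "indicator {0..R} r * G last_index r (z(last_index := 0)) =
      indicator {0..R} r * (indicator S (t - r\<^sup>2, x + r *\<^sub>R boundary_embed z) *
        d last_index (t - r\<^sup>2, x + r *\<^sub>R boundary_embed z)) * boundary_gauss z" for r z
  proof (cases "r \<in> {0..R}")
    case True
    then have "(t - r\<^sup>2, x + r *\<^sub>R boundary_embed z) \<in> S"
      using pt_in[of r "\<lambda>_. 0"] boundary_point_in[of r z] boundary_subset by (auto simp: pt_def)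
    then show ?thesis by (simp add: G_boundary)
  qed simp
  then show ?thesis by (simp only:) measurable
qed

lemma measurable_G_boundary_slice:
  "(\<lambda>z. - (indicator {0..R} r * G last_index r (z(last_index := 0)))) \<in> borel_measurable Q"
  using measurable_compose[OF measurable_Pair1' measurable_G_boundary, of r] by simp

lemma G_boundary_bound:
  "\<bar>- (indicator {0..R} r * G last_index r (z(last_index := 0)))\<bar> \<le> A * (\<Prod>i\<in>UNIV - {last_index}. w (z i))"
proof (cases "r \<in> {0..R}")
  case True
  have "\<bar>G last_index r (z(last_index := 0))\<bar> \<le> A * (\<Prod>i\<in>UNIV. w ((z(last_index := 0)) i))"
    by (rule G_bound) (use True in auto)
  also have "(\<Prod>i\<in>UNIV. w ((z(last_index := 0)) i)) = w 0 * (\<Prod>i\<in>UNIV - {last_index}. w (z i))"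
    by (rule prod_upd)
  finally show ?thesis using True by (simp add: w_def del: fun_upd_apply)
next
  case False
  then show ?thesis using A_nonneg w_nonneg by (simp add: prod_nonneg)
qed

lemma integrable_G_boundary: "integrable Q (\<lambda>z. - (indicator {0..R} r * G last_index r (z(last_index := 0))))"
proof (rule Bochner_Integration.integrable_bound[OF _ measurable_G_boundary_slice])
  show "integrable Q (\<lambda>z. A * (\<Prod>i\<in>UNIV - {last_index}. w (z i)))"
    by (intro integrable_mult_right integrable_prod_w) simp
  show "AE z in Q. norm (- (indicator {0..R} r * G last_index r (z(last_index := 0)))) \<le>
      norm (A * (\<Prod>i\<in>UNIV - {last_index}. w (z i)))"
    unfolding real_norm_def by (intro AE_I2 order_trans[OF G_boundary_bound abs_ge_self])
qed

lemma measurable_B: "B \<in> borel_measurable borel"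
proof -
  interpret product_sigma_finite "\<lambda>_. lborel :: real measure" by (rule product_sigma_finite_lborel)
  interpret Q: finite_product_sigma_finite "\<lambda>_. lborel :: real measure" "UNIV - {last_index :: 'n}" by standard simp
  have "B \<in> borel_measurable lborel"
    unfolding B_def[abs_def] by (rule Q.borel_measurable_lebesgue_integral[OF measurable_G_boundary])
  then show ?thesis by simp
qed

lemma B_bound: "\<bar>B r\<bar> \<le> (LINT z|Q. A * (\<Prod>i\<in>UNIV - {last_index}. w (z i)))"
proof -
  have "\<bar>B r\<bar> \<le> (LINT z|Q. \<bar>- (indicator {0..R} r * G last_index r (z(last_index := 0)))\<bar>)"
    unfolding B_def by (rule integral_abs_bound)
  also have "\<dots> \<le> (LINT z|Q. A * (\<Prod>i\<in>UNIV - {last_index}. w (z i)))"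
    by (intro integral_mono integrable_abs integrable_G_boundary integrable_mult_right integrable_prod_w G_boundary_bound) simp
  finally show ?thesis .
qed

lemma boundary_representation_B:
  "v (t, x) = 2 / sqrt (4 * pi) ^ CARD('n) * (2 * (LINT r|lborel. indicator {0..R} r * B r))"
proof -
  have "indicator {0..R} r * B r = indicator {0..R} r * (LINT z|Q. - G last_index r (z(last_index := 0)))" for r
    by (simp add: B_def indicator_def)
  then show ?thesis
    using boundary_representation by (simp add: field_simps)
qed

lemma boundary_value_measurable:
  "(\<lambda>r. indicator {0..R} r * d last_index (t - r\<^sup>2, x)) \<in> borel_measurable borel"
proof -
  have "continuous_on {0..R} (\<lambda>r. (t - r\<^sup>2, x))" by (intro continuous_intros)
  then have "continuous_on {0..R} (\<lambda>r. d last_index (t - r\<^sup>2, x))"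
    by (rule continuous_on_compose2[OF cont(1)]) (use pt_in[of _ "\<lambda>_. 0"] in \<open>auto simp: pt_def zero_vec_def[symmetric]\<close>)
  from borel_measurable_continuous_on_indicator[OF _ this] show ?thesis by simp
qed

text \<open>The inner integral of the flux difference is the term of
  \<open>boundary_representation_B\<close> minus q (s, x) times the kernel mass. Each part is a
  bounded function of \<open>sqrt (t - s)\<close> divided by \<open>sqrt (t - s)\<close>, hence
  integrable in time, so the integral may be split.\<close>

theorem flux_representation:
  assumes q: "\<And>s y. s \<in> {0..T} \<Longrightarrow> y \<in> half_space_boundary \<Longrightarrow> q s y = - d last_index (s, y)"
  shows "set_integrable lborel {0..t} (\<lambda>s. q s x / (pi * (t - s)) powr (1 / 2))"
    and "\<forall>s\<in>{0..<t}. integrable boundary_measure (\<lambda>y. (q s y - q s x) * boundary_kernel (t - s) x y)"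
    and "set_integrable lborel {0..t} (\<lambda>s. LINT y|boundary_measure. (q s y - q s x) * boundary_kernel (t - s) x y)"
    and "v (t, x) = (LBINT s:{0..t}. q s x / (pi * (t - s)) powr (1 / 2)) +
      (LBINT s:{0..t}. LINT y|boundary_measure. (q s y - q s x) * boundary_kernel (t - s) x y)"
proof -
  let ?c = "sqrt (4 * pi) ^ CARD('n)"
  \<comment> \<open>The flux at \<open>x\<close> as a function of r = \<open>sqrt (t - s)\<close>,
    extended by zero in order to be bounded and measurable on the whole line.\<close>
  define q0 where "q0 r = - (indicator {0..R} r * d last_index (t - r\<^sup>2, x))" for r
  have q0_meas: "q0 \<in> borel_measurable borel"
    unfolding q0_def[abs_def] using boundary_value_measurable by (rule borel_measurable_uminus)
  have q0_bound: "\<bar>q0 r\<bar> \<le> C * exp (C * norm x)" for r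
  proof (cases "r \<in> {0..R}")
    case True
    then have "t - r\<^sup>2 \<in> {0..T}" using pt_in[of r "\<lambda>_. 0"] by (simp add: pt_def)
    then show ?thesis using True x boundary_subset growth_d[of "t - r\<^sup>2" x last_index] by (auto simp: q0_def)
  qed (use C in \<open>simp add: q0_def\<close>)
  have in_R: "sqrt (t - s) \<in> {0..R}" "(sqrt (t - s))\<^sup>2 = t - s" "s \<in> {0..T}" if "s \<in> {0..t}" for s
    using that t by auto
  have q0: "q0 (sqrt (t - s)) = q s x" if "s \<in> {0..t}" for s
    using in_R[OF that] x by (simp add: q0_def q)
  have G: "- (indicator {0..R} (sqrt (t - s)) * G last_index (sqrt (t - s)) (z(last_index := 0))) =
      q s (x + sqrt (t - s) *\<^sub>R boundary_embed z) * boundary_gauss z" if "s \<in> {0..t}" for s z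
    using in_R[OF that] boundary_point_in[of "sqrt (t - s)" z] by (simp add: G_boundary q)

  \<comment> \<open>The endpoint s = t is included: both sides are then quotients by zero.\<close>
  have first: "q s x / (pi * (t - s)) powr (1 / 2) = 1 / sqrt pi * (q0 (sqrt (t - s)) / sqrt (t - s))"
    if "s \<in> {0..t}" for s
    using that q0[OF that] by (simp add: powr_half_sqrt real_sqrt_mult)
  show 1: "set_integrable lborel {0..t} (\<lambda>s. q s x / (pi * (t - s)) powr (1 / 2))"
  proof (subst set_integrable_cong[OF refl refl first])
    show "set_integrable lborel {0..t} (\<lambda>s. 1 / sqrt pi * (q0 (sqrt (t - s)) / sqrt (t - s)))"
      using set_integral_substitution_sqrt(1)[OF q0_meas q0_bound, of t] t
      by (intro set_integrable_mult_right) auto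
  qed

  have meas: "(\<lambda>y. q s y - q s x) \<in> borel_measurable (restrict_space borel half_space_boundary)" if "s \<in> {0..t}" for s
  proof -
    have "continuous_on half_space_boundary (\<lambda>y. (s, y))" by (intro continuous_intros)
    then have "continuous_on half_space_boundary (\<lambda>y. d last_index (s, y))"
      by (rule continuous_on_compose2[OF cont(1)]) (use in_R[OF that] boundary_subset in auto)
    then have "(\<lambda>y. - d last_index (s, y) - q s x) \<in> borel_measurable (restrict_space borel half_space_boundary)"
      by (intro borel_measurable_continuous_on_restrict continuous_intros)
    then show ?thesis
      by (rule measurable_cong[THEN iffD1, rotated]) (use q in_R[OF that] in \<open>simp add: space_restrict_space\<close>)
  qed
  have int: "integrable Q (\<lambda>z. q s (x + sqrt (t - s) *\<^sub>R boundary_embed z) * boundary_gauss z)" if "s \<in> {0..t}" for s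
    using integrable_G_boundary[of "sqrt (t - s)"] unfolding G[OF that] .
  show "\<forall>s\<in>{0..<t}. integrable boundary_measure (\<lambda>y. (q s y - q s x) * boundary_kernel (t - s) x y)"
  proof
    fix s assume s: "s \<in> {0..<t}"
    then have s': "s \<in> {0..t}" and "t - s > 0" by auto
    then show "integrable boundary_measure (\<lambda>y. (q s y - q s x) * boundary_kernel (t - s) x y)"
      using int[OF s'] boundary_gauss_integral(1)[where ?'n = 'n]
      by (subst boundary_measure_kernel(1)[OF meas[OF s'] _ x]) (auto simp: left_diff_distrib)
  qed

  have second: "(LINT y|boundary_measure. (q s y - q s x) * boundary_kernel (t - s) x y) =
      2 / ?c * (B (sqrt (t - s)) / sqrt (t - s)) - q s x / (pi * (t - s)) powr (1 / 2)" if s: "s \<in> {0..t}" for s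
  proof (cases "s = t")
    case True
    \<comment> \<open>both sides vanish, by division by zero\<close>
    then show ?thesis by (simp add: boundary_kernel_def)
  next
    case False
    then have "t - s > 0" using s by simp
    then have "(LINT y|boundary_measure. (q s y - q s x) * boundary_kernel (t - s) x y) =
        2 / (?c * sqrt (t - s)) * (LINT z|Q. (q s (x + sqrt (t - s) *\<^sub>R boundary_embed z) - q s x) * boundary_gauss z)"
      by (rule boundary_measure_kernel(2)[OF meas[OF s] _ x])
    also have "(LINT z|Q. (q s (x + sqrt (t - s) *\<^sub>R boundary_embed z) - q s x) * boundary_gauss z) =
        B (sqrt (t - s)) - q s x * (?c / sqrt (4 * pi))"
      using int[OF s] boundary_gauss_integral[where ?'n = 'n] by (simp add: left_diff_distrib B_def G[OF s])
    \<comment> \<open>Here \<open>?c\<close> cancels in the second term, leaving the kernel mass, as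
      2 / sqrt (4 pi) = 1 / sqrt pi.\<close>
    also have "2 / (?c * sqrt (t - s)) * (B (sqrt (t - s)) - q s x * (?c / sqrt (4 * pi))) =
        2 / ?c * (B (sqrt (t - s)) / sqrt (t - s)) - q s x * (2 / sqrt (4 * pi)) / sqrt (t - s)"
      using \<open>t - s > 0\<close> by (simp add: field_simps)
    also have "q s x * (2 / sqrt (4 * pi)) / sqrt (t - s) = q s x / (pi * (t - s)) powr (1 / 2)"
      using \<open>t - s > 0\<close> by (simp add: powr_half_sqrt real_sqrt_mult)
    finally show ?thesis .
  qed
  note sub = set_integral_substitution_sqrt[OF measurable_B B_bound, of t]
  have 2: "set_integrable lborel {0..t} (\<lambda>s. 2 / ?c * (B (sqrt (t - s)) / sqrt (t - s)))"
    using sub(1) t by (intro set_integrable_mult_right) auto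
  show "set_integrable lborel {0..t} (\<lambda>s. LINT y|boundary_measure. (q s y - q s x) * boundary_kernel (t - s) x y)"
    by (subst set_integrable_cong[OF refl refl second]) (use set_integral_diff(1)[OF 2 1] in auto)
  have "(LBINT s:{0..t}. LINT y|boundary_measure. (q s y - q s x) * boundary_kernel (t - s) x y) =
      (LBINT s:{0..t}. 2 / ?c * (B (sqrt (t - s)) / sqrt (t - s)) - q s x / (pi * (t - s)) powr (1 / 2))"
    by (rule set_lebesgue_integral_cong) (use second in auto)
  also have "\<dots> = (LBINT s:{0..t}. 2 / ?c * (B (sqrt (t - s)) / sqrt (t - s))) - (LBINT s:{0..t}. q s x / (pi * (t - s)) powr (1 / 2))"
    by (rule set_integral_diff(2)[OF 2 1])
  also have "(LBINT s:{0..t}. 2 / ?c * (B (sqrt (t - s)) / sqrt (t - s))) = v (t, x)"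
    unfolding set_integral_mult_right using sub(2) t by (simp add: boundary_representation_B)
  finally show "v (t, x) = (LBINT s:{0..t}. q s x / (pi * (t - s)) powr (1 / 2)) +
      (LBINT s:{0..t}. LINT y|boundary_measure. (q s y - q s x) * boundary_kernel (t - s) x y)"
    by simp
qed

end

subsection \<open>From iterated one-sided partial derivatives to the heat flow locale\<close>

text \<open>For a multi-index supported at \<open>i\<close> all other factors are identities. With k
  = 1 and k = 2 the growth hypothesis bounds \<open>d i\<close> and \<open>dd i\<close>.\<close>

lemma multi_partial_single:
  "multi_partial (\<lambda>j. if j = i then k else 0) f = (space_partial i ^^ k) f"
proof -
  have "foldr (\<lambda>j. space_partial j ^^ (if j = i then k else 0)) xs f =
      (if i \<in> set xs then (space_partial i ^^ k) f else f)" if "distinct xs" for xs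
    using that by (induction xs) auto
  then show ?thesis by (simp add: multi_partial_def)
qed

lemma has_partial_withinD:
  "has_partial_within S v f x \<Longrightarrow>
    ((\<lambda>h. f (x + h *\<^sub>R v)) has_real_derivative partial_within S v f x) (at 0 within {h. x + h *\<^sub>R v \<in> S})"
  unfolding has_partial_within_def partial_within_def has_real_derivative_iff_has_vector_derivative
  by (simp add: vector_derivative_works)

text \<open>The direction has no time component, so with \<open>s\<close> in {0..T} the cylinder and
  the half space admit the same increments.\<close>

lemma partial_within_space:
  assumes "s \<in> {0..T}"
  shows "partial_within ({0..T} \<times> half_space) (0, axis i 1) f (s, y) = space_partial i (\<lambda>y. f (s, y)) y"
  using assms by (simp add: partial_within_def space_partial_def)

lemma Basis_time_space:
  "(Basis :: (real \<times> (real ^ 'n::finite)) set) = insert (1, 0) (range (\<lambda>i. (0, axis i 1)))"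
  by (auto simp: Basis_prod_def Basis_vec_def)

lemma sum_Basis_time_space:
  fixes h :: "real \<times> (real ^ 'n::finite) \<Rightarrow> real"
  shows "(\<Sum>b\<in>Basis. h b) = h (1, 0) + (\<Sum>i\<in>UNIV. h (0, axis i 1))"
proof -
  have "inj (\<lambda>i. (0 :: real, axis i 1 :: real ^ 'n))" by (auto simp: inj_def axis_eq_axis)
  then show ?thesis
    unfolding Basis_time_space by (subst sum.insert) (auto simp: sum.reindex)
qed

text \<open>The cylinder is cut out by separate conditions on single coordinates, time and the last
  space coordinate, so it is closed under mixing the coordinates of two of its points.\<close>

lemma half_space_cylinder_mix:
  fixes p p' :: "real \<times> (real ^ 'n::{finite,linorder})"
  assumes "p \<in> {0..T} \<times> half_space" "p' \<in> {0..T} \<times> half_space" "A \<subseteq> Basis"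
  shows "p + (\<Sum>b\<in>A. ((p' - p) \<bullet> b) *\<^sub>R b) \<in> {0..T} \<times> half_space"
proof -
  have mem: "p \<in> {0..T} \<times> half_space \<longleftrightarrow> 0 \<le> p \<bullet> (1, 0) \<and> p \<bullet> (1, 0) \<le> T \<and> 0 \<le> p \<bullet> (0, axis last_index 1)"
    for p :: "real \<times> (real, 'n) vec"
    by (cases p) (auto simp: half_space_def inner_axis)
  have comp: "(p + (\<Sum>b\<in>A. ((p' - p) \<bullet> b) *\<^sub>R b)) \<bullet> b' = (if b' \<in> A then p' \<bullet> b' else p \<bullet> b')" if "b' \<in> Basis" for b'
  proof -
    have "(\<Sum>b\<in>A. ((p' - p) \<bullet> b) *\<^sub>R b) \<bullet> b' = (\<Sum>b\<in>A. if b = b' then (p' - p) \<bullet> b' else 0)"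
      unfolding inner_sum_left using assms(3) that by (intro sum.cong) (auto simp: inner_Basis)
    also have "\<dots> = (if b' \<in> A then (p' - p) \<bullet> b' else 0)"
      using finite_subset[OF assms(3) finite_Basis] by (simp add: sum.delta)
    finally show ?thesis by (simp add: inner_add_left inner_diff_left)
  qed
  have B: "(1, 0) \<in> (Basis :: (real \<times> (real, 'n) vec) set)" "(0, axis last_index 1) \<in> (Basis :: (real \<times> (real, 'n) vec) set)"
    by (auto simp: Basis_time_space)
  show ?thesis
    using assms(1,2) unfolding mem comp[OF B(1)] comp[OF B(2)] by auto
qed

lemma convex_half_space: "convex (half_space :: (real ^ 'n::{finite,linorder}) set)"
  by (auto simp: half_space_def convex_def)

theorem mainTheorem1:
  fixes u g q :: "real \<Rightarrow> real ^ 'n::{finite,linorder} \<Rightarrow> real"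
    and T :: real
  assumes T_pos: "T > 0"
    and smooth: "smooth_on ({0..T} \<times> half_space) (\<lambda>(t, x). u t x)"
    and heat: "\<And>t x. t \<in> {0..T} \<Longrightarrow> x \<in> half_space \<Longrightarrow>
        vector_derivative (\<lambda>s. u s x) (at t within {0..T}) = laplacian (u t) x"
    and initial: "\<And>x. x \<in> half_space \<Longrightarrow> u 0 x = 0"
    and growth: "\<And>\<gamma> :: 'n \<Rightarrow> nat. \<exists>C>0. \<forall>t\<in>{0..T}. \<forall>x\<in>half_space.
        \<bar>multi_partial \<gamma> (u t) x\<bar> \<le> C * exp (C * norm x)"
    and g: "\<And>t x. t \<in> {0..T} \<Longrightarrow> x \<in> half_space_boundary \<Longrightarrow> g t x = u t x"
    and q: "\<And>t x. t \<in> {0..T} \<Longrightarrow> x \<in> half_space_boundary \<Longrightarrow>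
        q t x = - space_partial last_index (u t) x"
  shows "\<forall>t\<in>{0<..T}. \<forall>x\<in>half_space_boundary.
      set_integrable lborel {0..t} (\<lambda>s. q s x / (pi * (t - s)) powr (1 / 2)) \<and>
      (\<forall>s\<in>{0..<t}. integrable boundary_measure
         (\<lambda>y. (q s y - q s x) * boundary_kernel (t - s) x y)) \<and>
      set_integrable lborel {0..t}
         (\<lambda>s. LINT y|boundary_measure. (q s y - q s x) * boundary_kernel (t - s) x y) \<and>
      g t x =
        (LBINT s:{0..t}. q s x / (pi * (t - s)) powr (1 / 2)) +
        (LBINT s:{0..t}. LINT y|boundary_measure. (q s y - q s x) * boundary_kernel (t - s) x y)"
proof -
  let ?S = "{0..T} \<times> (half_space :: (real, 'n) vec set)"
  define v where "v = (\<lambda>(t, x). u t x)"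
  define e :: "'n \<Rightarrow> real \<times> (real, 'n) vec" where "e i = (0, axis i 1)" for i
  define d where "d i = partial_within ?S (e i) v" for i
  define dd where "dd i = partial_within ?S (e i) (d i)" for i
  have e: "e i \<in> Basis" for i by (simp add: e_def Basis_time_space)
  have "Ck_on (Suc (Suc 0)) ?S v" using smooth unfolding smooth_on_def v_def by blast
  then have C2: "\<And>b. b \<in> Basis \<Longrightarrow> continuous_on ?S (partial_within ?S b v)"
    "\<And>b p. b \<in> Basis \<Longrightarrow> p \<in> ?S \<Longrightarrow> has_partial_within ?S b v p"
    "\<And>b b' p. b \<in> Basis \<Longrightarrow> b' \<in> Basis \<Longrightarrow> p \<in> ?S \<Longrightarrow> has_partial_within ?S b' (partial_within ?S b v) p"
    "\<And>b b'. b \<in> Basis \<Longrightarrow> b' \<in> Basis \<Longrightarrow> continuous_on ?S (partial_within ?S b' (partial_within ?S b v))"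
    by auto
  have d: "d i (s, y) = space_partial i (u s) y" if "s \<in> {0..T}" for i s y
    using partial_within_space[OF that, of i v y] by (simp add: d_def e_def v_def)
  have dd: "dd i (s, y) = space_partial i (space_partial i (u s)) y" if "s \<in> {0..T}" for i s y
    using partial_within_space[OF that, of i "d i" y] that by (simp add: dd_def e_def d)
  \<comment> \<open>\<open>heat\<close> differentiates in time at \<open>s\<close>,
    \<open>partial_within\<close> in an increment at 0. A translation identifies the two, the
    derivative being unique on the nondegenerate interval {0..T}.\<close>
  have time: "partial_within ?S (1, 0) v (s, y) = (\<Sum>i\<in>UNIV. dd i (s, y))" if sy: "(s, y) \<in> ?S" for s y
  proof -
    let ?D = "partial_within ?S (1, 0) v (s, y)"
    have "((\<lambda>h. u (s + h) y) has_real_derivative ?D) (at 0 within {h. s + h \<in> {0..T}})"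
      using has_partial_withinD[OF C2(2)[of "(1, 0)" "(s, y)"]] sy by (simp add: Basis_time_space v_def)
    then have "((\<lambda>s. u s y) has_real_derivative ?D) (at (s + 0) within (+) s ` {h. s + h \<in> {0..T}})"
      unfolding DERIV_at_within_shift .
    also have "(+) s ` {h. s + h \<in> {0..T}} = {0..T}"
      by (auto intro!: image_eqI[of _ _ "_ - s"])
    finally have "vector_derivative (\<lambda>s. u s y) (at s within {0..T}) = ?D"
      using T_pos sy
      by (intro vector_derivative_within_closed_interval) (auto simp: has_real_derivative_iff_has_vector_derivative)
    then show ?thesis using heat[of s y] sy by (simp add: laplacian_def dd)
  qed
  have "\<exists>K>0. \<forall>s\<in>{0..T}. \<forall>y\<in>half_space. \<bar>d i (s, y)\<bar> \<le> K * exp (K * norm y) \<and> \<bar>dd i (s, y)\<bar> \<le> K * exp (K * norm y)" for i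
  proof -
    \<comment> \<open>The function a exp (a n) is increasing in a, so K1 + K2 serves for both
      derivatives; the same monotonicity gives \<open>KC\<close> below.\<close>
    have m: "a * exp (a * n) \<le> (a + b) * exp ((a + b) * n)" if "a > 0" "b > 0" "n \<ge> 0" for a b n :: real
      using that by (intro mult_mono) (auto intro: mult_right_mono)
    obtain K1 where K1: "K1 > 0" "\<And>s y. s \<in> {0..T} \<Longrightarrow> y \<in> half_space \<Longrightarrow> \<bar>d i (s, y)\<bar> \<le> K1 * exp (K1 * norm y)"
      using growth[of "\<lambda>j. if j = i then 1 else 0"] unfolding multi_partial_single by (auto simp: d)
    obtain K2 where K2: "K2 > 0" "\<And>s y. s \<in> {0..T} \<Longrightarrow> y \<in> half_space \<Longrightarrow> \<bar>dd i (s, y)\<bar> \<le> K2 * exp (K2 * norm y)"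
      using growth[of "\<lambda>j. if j = i then 2 else 0"] unfolding multi_partial_single by (auto simp: dd numeral_2_eq_2)
    show ?thesis
    proof (intro exI[of _ "K1 + K2"] conjI ballI)
      fix s y assume sy: "s \<in> {0..T}" "y \<in> (half_space :: (real, 'n) vec set)"
      show "\<bar>d i (s, y)\<bar> \<le> (K1 + K2) * exp ((K1 + K2) * norm y)"
        by (rule order_trans[OF K1(2)[OF sy] m]) (use K1 K2 in auto)
      show "\<bar>dd i (s, y)\<bar> \<le> (K1 + K2) * exp ((K1 + K2) * norm y)"
        using order_trans[OF K2(2)[OF sy] m[of K2 K1]] K1 K2 by (simp add: add.commute)
    qed (use K1 K2 in simp)
  qed
  then obtain K where K: "\<And>i. K i > 0"
    and dK: "\<And>i s y. s \<in> {0..T} \<Longrightarrow> y \<in> half_space \<Longrightarrow> \<bar>d i (s, y)\<bar> \<le> K i * exp (K i * norm y)"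
    and ddK: "\<And>i s y. s \<in> {0..T} \<Longrightarrow> y \<in> half_space \<Longrightarrow> \<bar>dd i (s, y)\<bar> \<le> K i * exp (K i * norm y)"
    by metis
  \<comment> \<open>The sum of the positive \<open>K i\<close> dominates each of them: the locale
    asks for one constant for all directions.\<close>
  define C where "C = sum K UNIV"
  have "K i \<le> C" for i
    unfolding C_def using K by (intro member_le_sum) (auto simp: less_imp_le)
  then have KC: "K i * exp (K i * norm y) \<le> C * exp (C * norm y)" for i and y :: "(real, 'n) vec"
    using K[of i] by (intro mult_mono) (auto simp: mult_right_mono intro: order_trans[OF less_imp_le])
  show ?thesis
  proof (intro ballI)
    fix t and x :: "(real, 'n) vec" assume t: "t \<in> {0<..T}" and x: "x \<in> half_space_boundary"
    interpret half_space_heat v d dd T C t x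
    proof
      show "continuous_on ?S (d i)" "continuous_on ?S (dd i)" for i
        unfolding dd_def d_def using C2(1)[OF e] C2(4)[OF e e] by auto
      show "(v has_derivative (\<lambda>(h, k). h * (\<Sum>i\<in>UNIV. dd i p) + (\<Sum>i\<in>UNIV. k $ i * d i p))) (at p within ?S)"
        if p: "p \<in> ?S" for p
      proof -
        have "(v has_derivative (\<lambda>h. \<Sum>b\<in>Basis. (h \<bullet> b) * partial_within ?S b v p)) (at p within ?S)"
          by (rule has_derivative_of_continuous_partials[OF half_space_cylinder_mix _ has_partial_withinD[OF C2(2)] C2(1) p])
            (auto intro: convex_Times convex_half_space)
        \<comment> \<open>The basis splits into the time direction, whose partial is the Laplacian
          by \<open>time\<close>, and the space directions.\<close>
        also have "(\<lambda>h. \<Sum>b\<in>Basis. (h \<bullet> b) * partial_within ?S b v p) =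
            (\<lambda>(h, k). h * (\<Sum>i\<in>UNIV. dd i p) + (\<Sum>i\<in>UNIV. k $ i * d i p))"
          using time[of "fst p" "snd p"] p
          by (auto simp: sum_Basis_time_space fun_eq_iff inner_axis d_def e_def)
        finally show ?thesis .
      qed
      show "((\<lambda>h. d i (s, y + h *\<^sub>R axis i 1)) has_real_derivative dd i (s, y)) (at 0 within {h. y + h *\<^sub>R axis i 1 \<in> half_space})"
        if "s \<in> {0..T}" "y \<in> half_space" for i s y
        using has_partial_withinD[OF C2(3)[OF e e], of "(s, y)" i i] that
        by (simp add: d_def dd_def e_def)
      show "v (0, y) = 0" if "y \<in> half_space" for y using initial[OF that] by (simp add: v_def)
      show "C > 0" unfolding C_def using K by (intro sum_pos) auto
      show "\<bar>d i (s, y)\<bar> \<le> C * exp (C * norm y)" "\<bar>dd i (s, y)\<bar> \<le> C * exp (C * norm y)"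
        if "s \<in> {0..T}" "y \<in> half_space" for i s y
        using order_trans[OF dK[OF that] KC] order_trans[OF ddK[OF that] KC] by auto
    qed (use t x in auto)
    have "q s y = - d last_index (s, y)" if "s \<in> {0..T}" "y \<in> half_space_boundary" for s y
      using q[OF that] d[OF that(1)] by simp
    note rep = flux_representation[where q = q, OF this]
    have "g t x = v (t, x)" using g[of t x] t x by (simp add: v_def)
    with rep show "set_integrable lborel {0..t} (\<lambda>s. q s x / (pi * (t - s)) powr (1 / 2)) \<and>
      (\<forall>s\<in>{0..<t}. integrable boundary_measure
         (\<lambda>y. (q s y - q s x) * boundary_kernel (t - s) x y)) \<and>
      set_integrable lborel {0..t}
         (\<lambda>s. LINT y|boundary_measure. (q s y - q s x) * boundary_kernel (t - s) x y) \<and>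
      g t x =
        (LBINT s:{0..t}. q s x / (pi * (t - s)) powr (1 / 2)) +
        (LBINT s:{0..t}. LINT y|boundary_measure. (q s y - q s x) * boundary_kernel (t - s) x y)"
      by simp
  qed
qed

end
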